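(* Let $g\ge 0$, $p>0$ and $n\ge 3$. The representation $\rho_U: B_{n-1}(\Sigma_{g,p})\to \mathrm{Aut}(U_{n-1,g,p})$ is faithful (i.e. injective).
   Context: Conventions: $a^b=b^{-1}ab$ and $[a,b]=a^{-1}b^{-1}ab$. Automorphisms act on the right: a product $\alpha\beta$ of automorphisms means first $\alpha$, then $\beta$. $\Sigma_{g,p}$ is the compact connected orientable surface of genus $g$ with $p$ boundary components. $B_n(\Sigma)$ is the $n$-strand braid group of the surface $\Sigma$: isotopy classes (rel endpoints) of $n$-tuples of disjoint paths in $\Sigma\times[0,1]$, monotone in the $[0,1]$ coordinate, from $\mathcal P\times\{0\}$ to $\mathcal P\times\{1\}$, where $\mathcal P$ is a fixed set of $n$ interior points. For $p>0$ and $n\ge 2$, $B_n(\Sigma_{g,p})$ has the following presentation (known). Generators $\sigma_1,\dots,\sigma_{n-1},x_1,\dots,x_{2g},z_1,\dots,z_{p-1}$ (the $\sigma_i$ are the standard braid generators of an embedded disk; the $x_r$, $z_j$ are standard generators of $\pi_1(\Sigma_{g,p})$, the $z_j$ being loops around holes, performed by the first strand). Relations: $\sigma_i\sigma_{i+1}\sigma_i=\sigma_{i+1}\sigma_i\sigma_{i+1}$; $\sigma_i\sigma_j=\sigma_j\sigma_i$ for $|i-j|>1$; $x_r\sigma_i=\sigma_ix_r$ and $z_j\sigma_i=\sigma_iz_j$ for $i\ne1$; $(\sigma_1^{-1}x_r\sigma_1^{-1})x_r=x_r(\sigma_1^{-1}x_r\sigma_1^{-1})$; $(\sigma_1^{-1}x_s\sigma_1)x_r=x_r(\sigma_1^{-1}x_s\sigma_1)$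 for $s<r$, $(s,r)\neq(2m-1,2m)$; $(\sigma_1^{-1}x_{2m-1}\sigma_1^{-1})x_{2m}=x_{2m}(\sigma_1^{-1}x_{2m-1}\sigma_1)$ for $1\le m\le g$; $(\sigma_1^{-1}z_j\sigma_1)x_r=x_r(\sigma_1^{-1}z_j\sigma_1)$; $(\sigma_1^{-1}z_j\sigma_1)z_l=z_l(\sigma_1^{-1}z_j\sigma_1)$ for $j<l$; $(\sigma_1^{-1}z_j\sigma_1^{-1})z_j=z_j(\sigma_1^{-1}z_j\sigma_1^{-1})$. The subgroup of $B_n(\Sigma_{g,p})$ generated by $\sigma_1,\dots,\sigma_{n-2},x_1,\dots,x_{2g},z_1,\dots,z_{p-1}$ is isomorphic to, and identified with, $B_{n-1}(\Sigma_{g,p})$. In $B_n(\Sigma_{g,p})$ put $\tau_k=\sigma_{n-1}\cdots\sigma_{k+1}\sigma_k^2\sigma_{k+1}^{-1}\cdots\sigma_{n-1}^{-1}$ ($1\le k\le n-2$), $\tau_{n-1}=\sigma_{n-1}^2$, $w_r=\sigma_{n-1}\cdots\sigma_1x_r\sigma_1^{-1}\cdots\sigma_{n-1}^{-1}$ ($1\le r\le 2g$), $\xi_j=\sigma_{n-1}\cdots\sigma_1z_j\sigma_1^{-1}\cdots\sigma_{n-1}^{-1}$ ($1\le j\le p-1$). $U_{n-1,g,p}$ is the subgroup generated by all $\tau_k,w_r,\xi_j$; it is free on these $n+p+2g-2$ generators and is normalized by $B_{n-1}(\Sigma_{g,p})$. The representation $\rho_U$ is the conjugation action $u\mapsto u^\beta=\beta^{-1}u\beta$.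 Explicitly: $\sigma_i$ ($1\le i\le n-2$): $\tau_i\mapsto \tau_{i+1}^{\tau_i^{-1}}$, $\tau_{i+1}\mapsto \tau_i$, all other basis elements fixed. $x_r$ ($1\le r\le 2g$): $\tau_1\mapsto\tau_1^{w_r^{-1}\tau_1}$; $\tau_i\mapsto\tau_i$ for $i\ge2$; $w_s\mapsto w_s^{[w_r^{-1},\tau_1]}$ for $s<r$, $(s,r)\ne(2m-1,2m)$; $w_{r-1}\mapsto[\tau_1,w_r^{-1}]w_{r-1}\tau_1$ if $r=2m$; $w_r\mapsto w_r^{\tau_1}$; $w_s\mapsto w_s$ for $r<s$, $(r,s)\ne(2m-1,2m)$; $w_{r+1}\mapsto\tau_1^{-1}w_{r+1}$ if $r=2m-1$; $\xi_j\mapsto\xi_j^{[w_r^{-1},\tau_1]}$. $z_j$ ($1\le j\le p-1$): $\tau_1\mapsto\tau_1^{\xi_j^{-1}\tau_1}$; $\tau_i\mapsto\tau_i$ for $i\ge2$; $w_r\mapsto w_r$; $\xi_l\mapsto\xi_l^{[\xi_j^{-1},\tau_1]}$ for $l<j$; $\xi_j\mapsto\xi_j^{\tau_1}$; $\xi_l\mapsto\xi_l$ for $l>j$. *)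

theory Defs
  imports "HOL-Algebra.Bij" "HOL-Algebra.Generated_Groups"
begin

section \<open>Groups given by generators and relations\<close>

text \<open>
  A letter \<open>(x, True)\<close> stands for the generator \<open>x\<close>, a letter \<open>(x, False)\<close> for its formal inverse.
\<close>

type_synonym 'a word = "('a \<times> bool) list"

definition words :: "'a set \<Rightarrow> 'a word set" where
  "words X = lists (X \<times> UNIV)"

definition winv :: "'a word \<Rightarrow> 'a word" where
  "winv w = map (\<lambda>(x, e). (x, \<not> e)) (rev w)"

inductive pres_eq :: "'a set \<Rightarrow> ('a word \<times> 'a word) set \<Rightarrow> 'a word \<Rightarrow> 'a word \<Rightarrow> bool"
  for X :: "'a set" and R :: "('a word \<times> 'a word) set"
where
  refl: "w \<in> words X \<Longrightarrow> pres_eq X R w w"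
| sym: "pres_eq X R u v \<Longrightarrow> pres_eq X R v u"
| trans: "pres_eq X R u v \<Longrightarrow> pres_eq X R v w \<Longrightarrow> pres_eq X R u w"
| cong: "pres_eq X R u v \<Longrightarrow> a \<in> words X \<Longrightarrow> b \<in> words X \<Longrightarrow> pres_eq X R (a @ u @ b) (a @ v @ b)"
| cancel: "x \<in> X \<Longrightarrow> pres_eq X R [(x, e), (x, \<not> e)] []"
| rel: "(l, r) \<in> R \<Longrightarrow> l \<in> words X \<Longrightarrow> r \<in> words X \<Longrightarrow> pres_eq X R l r"

definition wclass :: "'a set \<Rightarrow> ('a word \<times> 'a word) set \<Rightarrow> 'a word \<Rightarrow> 'a word set" where
  "wclass X R w = {v. pres_eq X R w v}"

definition presented_group :: "'a set \<Rightarrow> ('a word \<times> 'a word) set \<Rightarrow> 'a word set monoid" where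
  "presented_group X R =
    \<lparr>carrier = wclass X R ` words X,
     mult = (\<lambda>A B. \<Union>a\<in>A. \<Union>b\<in>B. wclass X R (a @ b)),
     one = wclass X R []\<rparr>"

lemma pres_eq_words: "pres_eq X R u v \<Longrightarrow> u \<in> words X \<and> v \<in> words X"
  by (induction rule: pres_eq.induct) (auto simp: words_def)

lemma wclass_eq_iff:
  assumes "u \<in> words X"
  shows "wclass X R u = wclass X R v \<longleftrightarrow> pres_eq X R u v"
proof
  assume "wclass X R u = wclass X R v"
  moreover have "u \<in> wclass X R u"
    using assms by (simp add: wclass_def pres_eq.refl)
  ultimately have "pres_eq X R v u"
    by (simp add: wclass_def)
  then show "pres_eq X R u v"
    by (rule pres_eq.sym)
next
  assume uv: "pres_eq X R u v"
  show "wclass X R u = wclass X R v"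
    unfolding wclass_def using pres_eq.trans[OF uv] pres_eq.trans[OF pres_eq.sym[OF uv]] by blast
qed

lemma wclass_mult:
  assumes "u \<in> words X" "v \<in> words X"
  shows "wclass X R u \<otimes>\<^bsub>presented_group X R\<^esub> wclass X R v = wclass X R (u @ v)"
proof -
  have "wclass X R (a @ b) = wclass X R (u @ v)"
    if "a \<in> wclass X R u" "b \<in> wclass X R v" for a b
  proof -
    have ua: "pres_eq X R u a" and vb: "pres_eq X R v b"
      using that by (auto simp: wclass_def)
    have "pres_eq X R (u @ v) (a @ v)"
      using pres_eq.cong[OF ua, of "[]" v] assms by (auto simp: words_def)
    moreover have "pres_eq X R (a @ v) (a @ b)"
      using pres_eq.cong[OF vb, of a "[]"] pres_eq_words[OF ua] by (auto simp: words_def)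
    ultimately have "pres_eq X R (u @ v) (a @ b)"
      by (rule pres_eq.trans)
    then show ?thesis
      using wclass_eq_iff[of "u @ v" X R "a @ b"] assms by (auto simp: words_def)
  qed
  moreover have "u \<in> wclass X R u" "v \<in> wclass X R v"
    using assms by (simp_all add: wclass_def pres_eq.refl)
  ultimately have "(\<Union>a\<in>wclass X R u. \<Union>b\<in>wclass X R v. wclass X R (a @ b)) = wclass X R (u @ v)"
    by blast
  then show ?thesis
    by (simp add: presented_group_def)
qed

lemma winv_words: "w \<in> words X \<Longrightarrow> winv w \<in> words X"
  by (auto simp: words_def winv_def in_lists_conv_set)

lemma winv_cancel: "w \<in> words X \<Longrightarrow> pres_eq X R (winv w @ w) []"
proof (induction w)
  case Nil
  then show ?case by (auto simp: winv_def intro: pres_eq.refl)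
next
  case (Cons l w)
  obtain x e where l: "l = (x, e)" by (cases l)
  have w: "w \<in> words X" and x: "x \<in> X" using Cons.prems l by (auto simp: words_def)
  have "pres_eq X R (winv w @ [(x, \<not> e), (x, \<not> \<not> e)] @ w) (winv w @ [] @ w)"
    by (rule pres_eq.cong[OF pres_eq.cancel[OF x] winv_words[OF w] w])
  then have "pres_eq X R (winv (l # w) @ l # w) (winv w @ w)"
    by (simp add: winv_def l)
  then show ?case
    using Cons.IH[OF w] by (rule pres_eq.trans)
qed

lemma group_presented_group: "group (presented_group X R)"
proof (rule groupI)
  show "\<one>\<^bsub>presented_group X R\<^esub> \<in> carrier (presented_group X R)"
    by (auto simp: presented_group_def words_def)
next
  fix A assume "A \<in> carrier (presented_group X R)"
  then obtain a where a: "a \<in> words X" "A = wclass X R a"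
    by (auto simp: presented_group_def)
  have nil: "[] \<in> words X" by (simp add: words_def)
  have one: "\<one>\<^bsub>presented_group X R\<^esub> = wclass X R []" by (simp add: presented_group_def)
  show "\<one>\<^bsub>presented_group X R\<^esub> \<otimes>\<^bsub>presented_group X R\<^esub> A = A"
    using wclass_mult[OF nil a(1), of R] unfolding a(2) one by simp
  have "wclass X R (winv a) \<otimes>\<^bsub>presented_group X R\<^esub> A = wclass X R (winv a @ a)"
    unfolding a(2) by (rule wclass_mult[OF winv_words[OF a(1)] a(1)])
  also have "\<dots> = wclass X R []"
    using winv_cancel[OF a(1), of R] pres_eq_words by (metis wclass_eq_iff)
  finally show "\<exists>B\<in>carrier (presented_group X R).
      B \<otimes>\<^bsub>presented_group X R\<^esub> A = \<one>\<^bsub>presented_group X R\<^esub>"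
    unfolding one by (rule bexI) (simp add: presented_group_def winv_words[OF a(1)])
next
  fix A B assume "A \<in> carrier (presented_group X R)" "B \<in> carrier (presented_group X R)"
  then obtain a b where a: "a \<in> words X" "A = wclass X R a" and b: "b \<in> words X" "B = wclass X R b"
    by (auto simp: presented_group_def)
  have ab: "a @ b \<in> words X"
    using a b by (auto simp: words_def)
  show "A \<otimes>\<^bsub>presented_group X R\<^esub> B \<in> carrier (presented_group X R)"
    unfolding a(2) b(2) wclass_mult[OF a(1) b(1)] using ab by (simp add: presented_group_def)
  fix C assume "C \<in> carrier (presented_group X R)"
  then obtain c where c: "c \<in> words X" "C = wclass X R c"
    by (auto simp: presented_group_def)
  have "b @ c \<in> words X"
    using b c by (auto simp: words_def)
  with ab show "A \<otimes>\<^bsub>presented_group X R\<^esub> B \<otimes>\<^bsub>presented_group X R\<^esub> C =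
      A \<otimes>\<^bsub>presented_group X R\<^esub> (B \<otimes>\<^bsub>presented_group X R\<^esub> C)"
    using a b c by (simp add: wclass_mult)
qed


section \<open>Braid groups of orientable surfaces with boundary\<close>

datatype sbgen = Sigma nat | X nat | Z nat

abbreviation sg :: "nat \<Rightarrow> sbgen word" where "sg i \<equiv> [(Sigma i, True)]"
abbreviation sg' :: "nat \<Rightarrow> sbgen word" where "sg' i \<equiv> [(Sigma i, False)]"
abbreviation xg :: "nat \<Rightarrow> sbgen word" where "xg r \<equiv> [(X r, True)]"
abbreviation zg :: "nat \<Rightarrow> sbgen word" where "zg j \<equiv> [(Z j, True)]"

definition sb_gens :: "nat \<Rightarrow> nat \<Rightarrow> nat \<Rightarrow> sbgen set" where
  "sb_gens n g p = Sigma ` {1..<n} \<union> X ` {1..2 * g} \<union> Z ` {1..<p}"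

definition handle_pair :: "nat \<Rightarrow> nat \<Rightarrow> bool" where
  "handle_pair s r \<longleftrightarrow> (\<exists>m\<ge>1. s = 2 * m - 1 \<and> r = 2 * m)"

definition sb_rels :: "nat \<Rightarrow> nat \<Rightarrow> nat \<Rightarrow> (sbgen word \<times> sbgen word) set" where
  "sb_rels n g p =
     {(sg i @ sg (i+1) @ sg i, sg (i+1) @ sg i @ sg (i+1)) | i. i \<in> {1..<n} \<and> i + 1 \<in> {1..<n}}
   \<union> {(sg i @ sg j, sg j @ sg i) | i j.
        i \<in> {1..<n} \<and> j \<in> {1..<n} \<and> (i + 1 < j \<or> j + 1 < i)}
   \<union> {(xg r @ sg i, sg i @ xg r) | r i. r \<in> {1..2*g} \<and> i \<in> {1..<n} \<and> i \<noteq> 1}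
   \<union> {(zg j @ sg i, sg i @ zg j) | j i. j \<in> {1..<p} \<and> i \<in> {1..<n} \<and> i \<noteq> 1}
   \<union> {(sg' 1 @ xg r @ sg' 1 @ xg r, xg r @ sg' 1 @ xg r @ sg' 1) | r. r \<in> {1..2*g}}
   \<union> {(sg' 1 @ xg s @ sg 1 @ xg r, xg r @ sg' 1 @ xg s @ sg 1) | s r.
        s \<in> {1..2*g} \<and> r \<in> {1..2*g} \<and> s < r \<and> \<not> handle_pair s r}
   \<union> {(sg' 1 @ xg (2*m-1) @ sg' 1 @ xg (2*m), xg (2*m) @ sg' 1 @ xg (2*m-1) @ sg 1) | m.
        m \<in> {1..g}}
   \<union> {(sg' 1 @ zg j @ sg 1 @ xg r, xg r @ sg' 1 @ zg j @ sg 1) | j r.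
        j \<in> {1..<p} \<and> r \<in> {1..2*g}}
   \<union> {(sg' 1 @ zg j @ sg 1 @ zg l, zg l @ sg' 1 @ zg j @ sg 1) | j l.
        j \<in> {1..<p} \<and> l \<in> {1..<p} \<and> j < l}
   \<union> {(sg' 1 @ zg j @ sg' 1 @ zg j, zg j @ sg' 1 @ zg j @ sg' 1) | j. j \<in> {1..<p}}"

text \<open>
  The \<open>n\<close>-strand braid group of the surface of genus \<open>g\<close> with \<open>p\<close> boundary components,
  for \<open>n \<ge> 2\<close> and \<open>p > 0\<close>, through its known presentation by the standard generators.
\<close>

definition sb_group :: "nat \<Rightarrow> nat \<Rightarrow> nat \<Rightarrow> sbgen word set monoid" where
  "sb_group n g p = presented_group (sb_gens n g p) (sb_rels n g p)"

definition sb_elem :: "nat \<Rightarrow> nat \<Rightarrow> nat \<Rightarrow> sbgen word \<Rightarrow> sbgen word set" where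
  "sb_elem n g p w = wclass (sb_gens n g p) (sb_rels n g p) w"

text \<open>
  The homomorphism from the \<open>(n - 1)\<close>-strand group to the \<open>n\<close>-strand group that sends each standard
  generator to the generator of the same name: the class of \<open>w\<close> is sent to the class of \<open>w\<close>, which
  is independent of the representative because the generators and relations of the smaller group
  are among those of the larger one.
\<close>

definition sb_incl :: "nat \<Rightarrow> nat \<Rightarrow> nat \<Rightarrow> sbgen word set \<Rightarrow> sbgen word set" where
  "sb_incl n g p \<beta> = (\<Union>w\<in>\<beta>. sb_elem n g p w)"

lemma pres_eq_mono:
  assumes "pres_eq S R u v" "S \<subseteq> S'" "R \<subseteq> R'"
  shows "pres_eq S' R' u v"
  using assms(1)
proof induction
  case (refl w)
  then show ?case using assms(2) by (intro pres_eq.refl) (auto simp: words_def)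
next
  case (sym u v)
  then show ?case by (blast intro: pres_eq.sym)
next
  case (trans u v w)
  then show ?case by (blast intro: pres_eq.trans)
next
  case (cong u v a b)
  then show ?case using assms(2) by (intro pres_eq.cong) (auto simp: words_def)
next
  case (cancel x e)
  then show ?case using assms(2) by (intro pres_eq.cancel) auto
next
  case (rel l r)
  then show ?case using assms(2,3) by (intro pres_eq.rel) (auto simp: words_def)
qed

lemma sb_gens_mono: "m \<le> n \<Longrightarrow> sb_gens m g p \<subseteq> sb_gens n g p"
  by (auto simp: sb_gens_def)

lemma sb_rels_mono: "m \<le> n \<Longrightarrow> sb_rels m g p \<subseteq> sb_rels n g p"
  unfolding sb_rels_def by (intro Un_mono) (force+)

lemma sb_incl_elem:
  assumes "w \<in> words (sb_gens (n - 1) g p)"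
  shows "sb_incl n g p (sb_elem (n - 1) g p w) = sb_elem n g p w"
proof -
  have w: "w \<in> words (sb_gens n g p)"
    using assms sb_gens_mono[of "n - 1" n g p] by (auto simp: words_def)
  have "sb_elem n g p v = sb_elem n g p w" if "v \<in> sb_elem (n - 1) g p w" for v
  proof -
    have "pres_eq (sb_gens n g p) (sb_rels n g p) w v"
      using that pres_eq_mono[OF _ sb_gens_mono[of "n - 1" n] sb_rels_mono[of "n - 1" n]]
      by (simp add: sb_elem_def wclass_def)
    then show ?thesis
      unfolding sb_elem_def using wclass_eq_iff[OF w] by metis
  qed
  moreover have "w \<in> sb_elem (n - 1) g p w"
    using assms by (simp add: sb_elem_def wclass_def pres_eq.refl)
  ultimately show ?thesis
    unfolding sb_incl_def by blast
qed


section \<open>The action by conjugation on the subgroup U\<close>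

text \<open>\<open>sg_down n k\<close> is the word \<open>Sigma (n-1) \<dots> Sigma (k+1)\<close>, which is empty for \<open>k = n - 1\<close>.\<close>

definition sg_down :: "nat \<Rightarrow> nat \<Rightarrow> sbgen word" where
  "sg_down n k = concat (map sg (rev [k+1..<n]))"

definition tau :: "nat \<Rightarrow> nat \<Rightarrow> sbgen word" where
  "tau n k = sg_down n k @ sg k @ sg k @ winv (sg_down n k)"

definition w_gen :: "nat \<Rightarrow> nat \<Rightarrow> sbgen word" where
  "w_gen n r = sg_down n 0 @ xg r @ winv (sg_down n 0)"

definition xi :: "nat \<Rightarrow> nat \<Rightarrow> sbgen word" where
  "xi n j = sg_down n 0 @ zg j @ winv (sg_down n 0)"

text \<open>\<open>U_group n g p\<close> is the subgroup of the \<open>n\<close>-strand group written with index \<open>n - 1\<close>, \<open>g\<close>, \<open>p\<close>.\<close>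

definition U_group :: "nat \<Rightarrow> nat \<Rightarrow> nat \<Rightarrow> sbgen word set monoid" where
  "U_group n g p = subgroup_generated (sb_group n g p)
     (sb_elem n g p ` (tau n ` {1..<n} \<union> w_gen n ` {1..2 * g} \<union> xi n ` {1..<p}))"

text \<open>
  Automorphisms act on the right, so in a product the left factor is applied first;
  in \<^const>\<open>AutoGroup\<close> the right factor is.
\<close>

definition right_AutoGroup :: "('a, 'b) monoid_scheme \<Rightarrow> ('a \<Rightarrow> 'a) monoid" where
  "right_AutoGroup G = (AutoGroup G)\<lparr>mult := (\<lambda>\<alpha> \<beta>. \<beta> \<otimes>\<^bsub>AutoGroup G\<^esub> \<alpha>)\<rparr>"

definition rho_U :: "nat \<Rightarrow> nat \<Rightarrow> nat \<Rightarrow> sbgen word set \<Rightarrow> sbgen word set \<Rightarrow> sbgen word set" where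
  "rho_U n g p \<beta> = (\<lambda>u\<in>carrier (U_group n g p).
     inv\<^bsub>sb_group n g p\<^esub> (sb_incl n g p \<beta>) \<otimes>\<^bsub>sb_group n g p\<^esub> u
       \<otimes>\<^bsub>sb_group n g p\<^esub> sb_incl n g p \<beta>)"

end

theory Submission
  imports Defs
begin

text \<open>
  The explicit formulas of \<open>\<rho>\<^sub>U\<close> define, for every group, an action of the surface braid group on
  tuples indexed by the basis of \<open>U\<close>. The key observation is that a word in the generators of
  \<open>U\<close>, viewed as a braid that pushes the last strand, conjugates the last entry of a tuple by the
  value of that word, as long as this entry lies in an abelian normal subgroup. In a wreath
  product with \<open>\<int>/2\<close> the conjugates of a suitable last entry are pairwise distinct, so the value of
  the word can be read off.

  Two consequences give the theorem. By induction on the number \<open>m\<close> of strands, the action of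
  \<open>B\<^sub>m\<close> on tuples is faithful: an element that acts trivially lies in \<open>U B\<^bsub>m-1\<^esub>\<close>, its second factor is
  trivial by induction, and its first factor is a word whose value is trivial in every group, in
  particular in \<open>B\<^sub>m\<close>. And if \<open>\<beta>\<close> in \<open>B\<^bsub>n-1\<^esub>\<close> commutes with \<open>U\<close> inside \<open>B\<^sub>n\<close>, then pushing the last strand
  before and after \<open>\<beta>\<close> shows that \<open>\<beta>\<close> preserves all tuples, hence is trivial.
\<close>

section \<open>Multiplicative groups as a type class\<close>

text \<open>A group that fills a whole type needs no carrier conditions: tuples become plain
  functions, and \<open>mult.assoc\<close> with the cancellation rules normalises group
  words.\<close>

class mult_group = monoid_mult +
  fixes ginv :: "'a \<Rightarrow> 'a"  ("_\<^sup>-" [1000] 999)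
  assumes left_ginv [simp]: "a\<^sup>- * a = 1"
begin

lemma left_ginv_cancel [simp]: "a\<^sup>- * (a * b) = b"
  by (simp flip: mult.assoc)

lemma mult_left_cancel_iff: "a * b = a * c \<longleftrightarrow> b = c"
  using left_ginv_cancel by metis

lemma right_ginv [simp]: "a * a\<^sup>- = 1"
  by (metis left_ginv left_ginv_cancel mult.assoc mult_1_left mult_1_right)

lemma right_ginv_cancel [simp]: "a * (a\<^sup>- * b) = b"
  by (simp flip: mult.assoc)

lemma ginv_unique: "a * b = 1 \<Longrightarrow> a\<^sup>- = b"
  by (metis left_ginv_cancel mult_1_right)

lemma ginv_ginv [simp]: "(a\<^sup>-)\<^sup>- = a"
  by (rule ginv_unique) simp

lemma ginv_one [simp]: "1\<^sup>- = 1"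
  by (rule ginv_unique) simp

lemma ginv_mult [simp]: "(a * b)\<^sup>- = b\<^sup>- * a\<^sup>-"
  by (rule ginv_unique) (simp add: mult.assoc)

lemma mult_right_cancel_iff: "b * a = c * a \<longleftrightarrow> b = c"
  by (metis mult.assoc mult_1_right right_ginv)

lemma ginv_mult_eq_one_iff: "a\<^sup>- * b = 1 \<longleftrightarrow> b = a"
  by (metis left_ginv mult_left_cancel_iff)

end

section \<open>Symmetric groups and wreath products\<close>

typedef 'a sym = "{f :: 'a \<Rightarrow> 'a. bij f}"
  by (rule exI[of _ id]) simp

lemma bij_Rep_sym: "bij (Rep_sym p)"
  using Rep_sym[of p] by simp

instantiation sym :: (type) mult_group
begin

definition "1 = Abs_sym id"
definition "p * q = Abs_sym (Rep_sym p \<circ> Rep_sym q)"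
definition "ginv p = Abs_sym (inv_into UNIV (Rep_sym p))"

instance
proof
  fix a b c :: "'a sym"
  show "a * b * c = a * (b * c)"
    by (simp add: times_sym_def Abs_sym_inverse bij_Rep_sym bij_comp comp_assoc)
  show "1 * a = a" "a * 1 = a"
    by (simp_all add: times_sym_def one_sym_def Abs_sym_inverse Rep_sym_inverse)
  show "a\<^sup>- * a = 1"
    by (simp add: times_sym_def one_sym_def ginv_sym_def Abs_sym_inverse bij_Rep_sym
        bij_imp_bij_inv bij_is_inj)
qed

end

lemma Rep_sym_one [simp]: "Rep_sym 1 = id"
  by (simp add: one_sym_def Abs_sym_inverse)

lemma Rep_sym_mult [simp]: "Rep_sym (p * q) x = Rep_sym p (Rep_sym q x)"
  by (simp add: times_sym_def Abs_sym_inverse bij_Rep_sym bij_comp)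

lemma Rep_sym_ginv: "Rep_sym (p\<^sup>-) = inv_into UNIV (Rep_sym p)"
  by (simp add: ginv_sym_def Abs_sym_inverse bij_Rep_sym bij_imp_bij_inv)

lemma Rep_sym_ginv_left [simp]: "Rep_sym (p\<^sup>-) (Rep_sym p x) = x"
  by (metis Rep_sym_mult Rep_sym_one id_apply left_ginv)

lemma Rep_sym_ginv_right [simp]: "Rep_sym p (Rep_sym (p\<^sup>-) x) = x"
  by (metis Rep_sym_mult Rep_sym_one id_apply right_ginv)

lemma sym_eqI: "(\<And>x. Rep_sym p x = Rep_sym q x) \<Longrightarrow> p = q"
  by (meson Rep_sym_inject ext)

text \<open>
  The wreath product of \<open>\<int>/2\<close> with a group: a set stands for the element of the base group that is
  nontrivial exactly at its members.
\<close>

datatype 'a wr = Wr (wr_set: "'a set") (wr_top: 'a)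

instantiation wr :: (mult_group) mult_group
begin

definition "1 = Wr {} 1"
definition "x * y = Wr {c. (c \<in> wr_set x) \<noteq> ((wr_top x)\<^sup>- * c \<in> wr_set y)} (wr_top x * wr_top y)"
definition "ginv x = Wr {c. wr_top x * c \<in> wr_set x} ((wr_top x)\<^sup>-)"

instance
  by standard (auto simp: times_wr_def one_wr_def ginv_wr_def mult.assoc set_eq_iff intro: wr.expand)

end

lemma wr_top_simps [simp]:
  "wr_top 1 = 1" "wr_top (x * y) = wr_top x * wr_top y" "wr_top (x\<^sup>-) = (wr_top x)\<^sup>-"
  by (simp_all add: times_wr_def one_wr_def ginv_wr_def)

lemma wr_base_commute: "wr_top x = 1 \<Longrightarrow> wr_top y = 1 \<Longrightarrow> x * y = y * x"
  by (auto simp: times_wr_def)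

text \<open>The base group is abelian, so conjugation of its elements depends only on the top component.\<close>

lemma wr_base_conj:
  assumes "wr_top x = wr_top x'" "wr_top y = 1"
  shows "x * y * x\<^sup>- = x' * y * x'\<^sup>-"
proof -
  have "(x'\<^sup>- * x) * y = y * (x'\<^sup>- * x)"
    by (rule wr_base_commute) (use assms in simp_all)
  then have "x' * ((x'\<^sup>- * x) * y) * x\<^sup>- = x' * (y * (x'\<^sup>- * x)) * x\<^sup>-"
    by simp
  then show ?thesis
    by (simp add: mult.assoc)
qed

text \<open>Conjugation by \<open>x\<close> translates the single point 1 of the base element to
  \<open>wr_top x\<close>, so the conjugate remembers the top of the conjugator.\<close>

lemma wr_conj_point:
  fixes x y :: "'a::mult_group wr"
  assumes "x * Wr {1} 1 * x\<^sup>- = y * Wr {1} 1 * y\<^sup>-"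
  shows "wr_top x = wr_top y"
proof -
  have *: "wr_set (x * Wr {1} 1 * x\<^sup>-) = {wr_top x}" for x :: "'a wr"
    by (auto simp: times_wr_def ginv_wr_def ginv_mult_eq_one_iff)
  show ?thesis using *[of x] *[of y] assms by simp
qed

section \<open>Words in a group and the regular representation\<close>

fun ev :: "('x \<Rightarrow> 'a::mult_group) \<Rightarrow> 'x word \<Rightarrow> 'a" where
  "ev f [] = 1"
| "ev f ((x, e) # w) = (if e then f x else (f x)\<^sup>-) * ev f w"

lemma ev_append [simp]: "ev f (u @ v) = ev f u * ev f v"
  by (induction f u rule: ev.induct) (auto simp: mult.assoc)

lemma ev_winv [simp]: "ev f (winv w) = (ev f w)\<^sup>-"
  by (induction f w rule: ev.induct) (auto simp: winv_def)

lemma ev_pres_eq: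
  assumes "pres_eq S R u v"
    and "\<And>l r. (l, r) \<in> R \<Longrightarrow> l \<in> words S \<Longrightarrow> r \<in> words S \<Longrightarrow> ev f l = ev f r"
  shows "ev f u = ev f v"
  using assms(1)
proof induction
  case (rel l r)
  then show ?case by (rule assms(2))
qed auto

lemma words_append [simp]: "u @ v \<in> words S \<longleftrightarrow> u \<in> words S \<and> v \<in> words S"
  by (auto simp: words_def)

lemma words_Nil [simp]: "[] \<in> words S"
  by (simp add: words_def)

lemma words_Cons [simp]: "(x, e) # w \<in> words S \<longleftrightarrow> x \<in> S \<and> w \<in> words S"
  by (simp add: words_def)

lemma winv_winv [simp]: "winv (winv w) = w"
  by (simp add: winv_def rev_map comp_def case_prod_beta)

lemma winv_words_iff [simp]: "winv w \<in> words S \<longleftrightarrow> w \<in> words S"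
  by (metis winv_winv winv_words)

lemma words_mono: "w \<in> words S \<Longrightarrow> S \<subseteq> S' \<Longrightarrow> w \<in> words S'"
  by (auto simp: words_def)

lemma winv_cancel_right:
  assumes "w \<in> words S"
  shows "pres_eq S R (w @ winv w) []"
  using winv_cancel[of "winv w"] assms by simp

text \<open>The identity outside the carrier makes left multiplication a permutation of the whole type.\<close>

definition cayley_map :: "'x set \<Rightarrow> ('x word \<times> 'x word) set \<Rightarrow> 'x word \<Rightarrow> 'x word set \<Rightarrow> 'x word set"
  where "cayley_map S R w A =
    (if A \<in> wclass S R ` words S then wclass S R w \<otimes>\<^bsub>presented_group S R\<^esub> A else A)"

definition cayley :: "'x set \<Rightarrow> ('x word \<times> 'x word) set \<Rightarrow> 'x \<Rightarrow> 'x word set sym" where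
  "cayley S R x = Abs_sym (if x \<in> S then cayley_map S R [(x, True)] else id)"

lemma cayley_map_append:
  assumes "u \<in> words S" "v \<in> words S"
  shows "cayley_map S R u (cayley_map S R v A) = cayley_map S R (u @ v) A"
  using assms by (auto simp: cayley_map_def wclass_mult)

lemma wclass_winv:
  assumes "w \<in> words S"
  shows "wclass S R (winv w @ w) = wclass S R []" "wclass S R (w @ winv w) = wclass S R []"
  using assms by (simp_all add: wclass_eq_iff winv_cancel winv_cancel_right)

lemma cayley_map_Nil: "cayley_map S R [] A = A"
  by (auto simp: cayley_map_def wclass_mult)

lemma cayley_map_cong: "wclass S R u = wclass S R v \<Longrightarrow> cayley_map S R u = cayley_map S R v"
  by (simp add: cayley_map_def fun_eq_iff)

lemma cayley_map_winv:
  assumes "w \<in> words S"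
  shows "cayley_map S R (winv w) (cayley_map S R w A) = A"
    and "cayley_map S R w (cayley_map S R (winv w) A) = A"
proof -
  have "cayley_map S R (winv w @ w) = cayley_map S R []" "cayley_map S R (w @ winv w) = cayley_map S R []"
    by (rule cayley_map_cong; rule wclass_winv[OF assms])+
  then show "cayley_map S R (winv w) (cayley_map S R w A) = A"
    and "cayley_map S R w (cayley_map S R (winv w) A) = A"
    using assms by (simp_all add: cayley_map_append cayley_map_Nil)
qed

lemma Rep_ev_cayley:
  assumes "w \<in> words S"
  shows "Rep_sym (ev (cayley S R) w) = cayley_map S R w"
  using assms
proof (induction w)
  case Nil
  then show ?case by (simp add: fun_eq_iff cayley_map_Nil)
next
  case (Cons l w)
  obtain x e where l: "l = (x, e)" by (cases l)
  have w: "w \<in> words S" and x: "x \<in> S" using Cons.prems l by auto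
  let ?c = "cayley_map S R [(x, True)]"
  have inv: "cayley_map S R [(x, False)] (?c A) = A" "?c (cayley_map S R [(x, False)] A) = A" for A
    using cayley_map_winv[of "[(x, True)]" S R A] x by (simp_all add: winv_def)
  then have bij: "bij ?c"
    by (intro o_bij[of "cayley_map S R [(x, False)]"]) (auto simp: fun_eq_iff)
  then have R: "Rep_sym (cayley S R x) = ?c"
    using x by (simp add: cayley_def Abs_sym_inverse)
  have R': "Rep_sym ((cayley S R x)\<^sup>-) = cayley_map S R [(x, False)]"
    unfolding Rep_sym_ginv R by (rule inv_unique_comp) (auto simp: fun_eq_iff inv)
  have "Rep_sym (ev (cayley S R) (l # w)) A = cayley_map S R [(x, e)] (cayley_map S R w A)" for A
    by (cases e) (simp_all add: l R R' Cons.IH[OF w])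
  then show ?case
    using x w by (simp add: fun_eq_iff cayley_map_append l)
qed

text \<open>Left multiplication applied to the class of the empty word returns the class of the
  multiplier, so the regular representation separates elements. This turns equal values in a group
  type into equality in the presentation.\<close>

lemma ev_cayley_iff:
  assumes "u \<in> words S" "v \<in> words S"
  shows "ev (cayley S R) u = ev (cayley S R) v \<longleftrightarrow> pres_eq S R u v"
proof -
  have Nil: "cayley_map S R w (wclass S R []) = wclass S R w" if "w \<in> words S" for w
    using that wclass_mult[OF that, of "[]" R] by (simp add: cayley_map_def)
  have "ev (cayley S R) u = ev (cayley S R) v \<longleftrightarrow> cayley_map S R u = cayley_map S R v"
    unfolding Rep_sym_inject[symmetric] Rep_ev_cayley[OF assms(1)] Rep_ev_cayley[OF assms(2)] ..
  also have "\<dots> \<longleftrightarrow> wclass S R u = wclass S R v"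
    using Nil[OF assms(1)] Nil[OF assms(2)] cayley_map_cong by metis
  also have "\<dots> \<longleftrightarrow> pres_eq S R u v"
    by (rule wclass_eq_iff[OF assms(1)])
  finally show ?thesis .
qed

section \<open>The action on tuples\<close>

text \<open>
  In the order \<open>Z 1 < Z 2 < \<dots> < X 1 < X 2 < \<dots>\<close> the relations for the \<open>z\<close> generators are instances of
  those for the \<open>x\<close> generators.
\<close>

fun below :: "sbgen \<Rightarrow> sbgen \<Rightarrow> bool" where
  "below (Z j) (Z l) \<longleftrightarrow> j < l"
| "below (Z j) (X r) \<longleftrightarrow> True"
| "below (X s) (X r) \<longleftrightarrow> s < r"
| "below _ _ \<longleftrightarrow> False"

fun handle :: "sbgen \<Rightarrow> sbgen \<Rightarrow> bool" where
  "handle (X s) (X r) \<longleftrightarrow> handle_pair s r"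
| "handle _ _ \<longleftrightarrow> False"

definition loop :: "sbgen \<Rightarrow> bool" where
  "loop a \<longleftrightarrow> (\<forall>i. a \<noteq> Sigma i)"

lemma handle_pair_iff: "handle_pair s r \<longleftrightarrow> odd s \<and> r = Suc s"
  unfolding handle_pair_def by (auto elim!: oddE)

lemma below_Sigma [simp]: "\<not> below (Sigma i) a" "\<not> below a (Sigma i)"
  by (cases a; simp)+

lemma handle_Sigma [simp]: "\<not> handle (Sigma i) a" "\<not> handle a (Sigma i)"
  by (cases a; simp)+

lemma loop_Sigma [simp]: "\<not> loop (Sigma i)" "loop (X r)" "loop (Z j)"
  by (simp_all add: loop_def)

lemma below_irrefl [simp]: "\<not> below a a" "\<not> handle a a"
  by (cases a; simp add: handle_pair_iff)+

text \<open>
  A tuple stores the values of \<open>\<tau>\<^sub>k\<close>, \<open>w\<^sub>r\<close>, \<open>\<xi>\<^sub>j\<close> at \<open>Sigma k\<close>, \<open>X r\<close>, \<open>Z j\<close>. The generators act by the explicit formulas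
  for \<open>\<rho>\<^sub>U\<close>, where \<open>c\<close> is the commutator \<open>[\<tau>\<^sub>1, w\<^sub>r\<^sup>-]\<close>. Substituting into tuples turns the right action of
  automorphisms into a left action, and tuples in arbitrary groups replace the free group.
\<close>

definition braid_act :: "nat \<Rightarrow> (sbgen \<Rightarrow> 'a::mult_group) \<Rightarrow> sbgen \<Rightarrow> 'a" where
  "braid_act i g = g(Sigma i := g (Sigma i) * g (Sigma (Suc i)) * (g (Sigma i))\<^sup>-,
    Sigma (Suc i) := g (Sigma i))"

definition braid_act_inv :: "nat \<Rightarrow> (sbgen \<Rightarrow> 'a::mult_group) \<Rightarrow> sbgen \<Rightarrow> 'a" where
  "braid_act_inv i g = g(Sigma i := g (Sigma (Suc i)),
    Sigma (Suc i) := (g (Sigma (Suc i)))\<^sup>- * g (Sigma i) * g (Sigma (Suc i)))"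

definition loop_act :: "sbgen \<Rightarrow> (sbgen \<Rightarrow> 'a::mult_group) \<Rightarrow> sbgen \<Rightarrow> 'a" where
  "loop_act a g d =
    (let t = g (Sigma 1); c = t\<^sup>- * g a * t * (g a)\<^sup>- in
     if d = Sigma 1 \<or> d = a then c * g d
     else if handle d a then c * g d * t
     else if handle a d then t\<^sup>- * g d
     else if below d a then c * g d * c\<^sup>-
     else g d)"

text \<open>With old entries t at \<open>Sigma 1\<close> and w at \<open>a\<close>, the new ones are
  c t and c w = t^-1 w t. Conjugating the former by the latter gives back t, and then c is the new
  entry at \<open>Sigma 1\<close> times t^-1; each branch undoes its counterpart in
  \<open>loop_act\<close>.\<close>

definition loop_act_inv :: "sbgen \<Rightarrow> (sbgen \<Rightarrow> 'a::mult_group) \<Rightarrow> sbgen \<Rightarrow> 'a" where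
  "loop_act_inv a g d =
    (let t = (g a)\<^sup>- * g (Sigma 1) * g a; c = g (Sigma 1) * t\<^sup>- in
     if d = Sigma 1 \<or> d = a then c\<^sup>- * g d
     else if handle d a then c\<^sup>- * g d * t\<^sup>-
     else if handle a d then t * g d
     else if below d a then c\<^sup>- * g d * c
     else g d)"

fun gen_act :: "sbgen \<Rightarrow> (sbgen \<Rightarrow> 'a::mult_group) \<Rightarrow> sbgen \<Rightarrow> 'a" where
  "gen_act (Sigma i) = braid_act i"
| "gen_act a = loop_act a"

fun gen_act_inv :: "sbgen \<Rightarrow> (sbgen \<Rightarrow> 'a::mult_group) \<Rightarrow> sbgen \<Rightarrow> 'a" where
  "gen_act_inv (Sigma i) = braid_act_inv i"
| "gen_act_inv a = loop_act_inv a"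

lemma gen_act_loop: "loop a \<Longrightarrow> gen_act a = loop_act a" "loop a \<Longrightarrow> gen_act_inv a = loop_act_inv a"
  by (cases a; simp add: fun_eq_iff)+

lemma braid_act_inverse:
  "braid_act_inv i (braid_act i g) = g" "braid_act i (braid_act_inv i g) = g"
  by (auto simp: braid_act_def braid_act_inv_def fun_eq_iff mult.assoc)

lemma loop_act_inverse:
  assumes "loop a"
  shows "loop_act_inv a (loop_act a g) = g" "loop_act a (loop_act_inv a g) = g"
proof -
  have "a \<noteq> Sigma i" for i using assms by (auto simp: loop_def)
  then show "loop_act_inv a (loop_act a g) = g" "loop_act a (loop_act_inv a g) = g"
    by (auto simp: loop_act_def loop_act_inv_def Let_def fun_eq_iff mult.assoc)
qed

lemma gen_act_inverse: "gen_act_inv s (gen_act s g) = g" "gen_act s (gen_act_inv s g) = g"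
  by (cases s; simp add: braid_act_inverse loop_act_inverse)+

definition gen_sym :: "sbgen \<Rightarrow> (sbgen \<Rightarrow> 'a::mult_group) sym" where
  "gen_sym s = Abs_sym (gen_act s)"

lemma bij_gen_act: "bij (gen_act s)"
  by (intro o_bij[of "gen_act_inv s"]) (auto simp: fun_eq_iff gen_act_inverse)

lemma Rep_gen_sym: "Rep_sym (gen_sym s) = gen_act s"
  by (simp add: gen_sym_def Abs_sym_inverse bij_gen_act)

lemma Rep_gen_sym_inv: "Rep_sym ((gen_sym s)\<^sup>-) = gen_act_inv s"
  unfolding Rep_sym_ginv Rep_gen_sym
  by (rule inv_unique_comp) (auto simp: fun_eq_iff gen_act_inverse)

definition act :: "sbgen word \<Rightarrow> (sbgen \<Rightarrow> 'a::mult_group) \<Rightarrow> sbgen \<Rightarrow> 'a" where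
  "act w = Rep_sym (ev gen_sym w)"

lemma act_Nil [simp]: "act [] g = g"
  by (simp add: act_def)

lemma act_append [simp]: "act (u @ v) g = act u (act v g)"
  by (simp add: act_def)

lemma act_Cons:
  "act ((s, True) # w) g = gen_act s (act w g)"
  "act ((s, False) # w) g = gen_act_inv s (act w g)"
  by (simp_all add: act_def Rep_gen_sym Rep_gen_sym_inv)

lemma act_winv [simp]: "act (winv w) (act w g) = g" "act w (act (winv w) g) = g"
  by (simp_all add: act_def)

section \<open>The defining relations hold on tuples\<close>

lemma act_rel_loop_self:
  assumes "loop a"
  shows "act (sg' 1 @ [(a, True)] @ sg' 1 @ [(a, True)]) g = act ([(a, True)] @ sg' 1 @ [(a, True)] @ sg' 1) g"
    (is "?l = ?r")
proof
  fix d
  have a: "a \<noteq> Sigma i" "Sigma i \<noteq> a" for i using assms by (auto simp: loop_def)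
  consider "d = Sigma 1" | "d = Sigma 2" | "d = a" | "d \<noteq> Sigma 1" "d \<noteq> Sigma 2" "d \<noteq> a"
    by blast
  then show "?l d = ?r d"
    using a
    by cases (simp_all add: act_Cons gen_act_loop assms loop_act_def braid_act_inv_def Let_def mult.assoc numeral_2_eq_2)
qed

text \<open>The branch of \<open>loop_act\<close> taken at \<open>d\<close> depends on its position
  relative to \<open>a\<close> and \<open>b\<close>. Handle partners are neighbours in the order, so
  being the partner of one of \<open>a\<close>, \<open>b\<close> determines the position relative to
  the other.\<close>

lemma act_rel_below:
  assumes "loop a" "loop b" "below b a" "\<not> handle b a"
  shows "act (sg' 1 @ [(b, True)] @ sg 1 @ [(a, True)]) g = act ([(a, True)] @ sg' 1 @ [(b, True)] @ sg 1) g"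
    (is "?l = ?r")
proof
  fix d
  have a: "a \<noteq> Sigma i" "Sigma i \<noteq> a" "b \<noteq> Sigma i" "Sigma i \<noteq> b" for i using assms by (auto simp: loop_def)
  note defs = act_Cons gen_act_loop assms loop_act_def braid_act_inv_def braid_act_def Let_def mult.assoc numeral_2_eq_2
  have ab: "a \<noteq> b" "b \<noteq> a" "\<not> below a b" "\<not> handle a b"
    using assms(3) by (cases a; cases b; auto simp: handle_pair_iff)+
  consider "d = Sigma 1" | "d = Sigma 2" | "d = a" | "d = b" | "handle d a" | "handle a d" | "handle d b" | "handle b d"
    | "d \<noteq> Sigma 1" "d \<noteq> Sigma 2" "d \<noteq> a" "d \<noteq> b" "\<not> handle d a" "\<not> handle a d" "\<not> handle d b" "\<not> handle b d" 
    by blast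
  then show "?l d = ?r d"
  proof cases
    case 5
    then have "d \<noteq> b" "d \<noteq> a" "\<not> handle d b" "\<not> handle b d" "\<not> below d b" "\<not> handle a d" "d \<noteq> Sigma i" for i
      using assms ab by (cases a; cases b; cases d; auto simp: handle_pair_iff)+
    then show ?thesis using a ab 5 by (simp add: defs)
  next
    case 6
    then have "d \<noteq> b" "d \<noteq> a" "\<not> handle d b" "\<not> handle b d" "\<not> below d b" "\<not> handle d a" "\<not> below d a" "d \<noteq> Sigma i" for i
      using assms ab by (cases a; cases b; cases d; auto simp: handle_pair_iff)+
    then show ?thesis using a ab 6 by (simp add: defs)
  next
    case 7
    then have "d \<noteq> b" "d \<noteq> a" "\<not> handle d a" "\<not> handle a d" "below d a" "\<not> handle b d" "d \<noteq> Sigma i" for i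
      using assms ab by (cases a; cases b; cases d; auto simp: handle_pair_iff)+
    then show ?thesis using a ab 7 by (simp add: defs)
  next
    case 8
    then have "d \<noteq> b" "d \<noteq> a" "\<not> handle d a" "\<not> handle a d" "below d a" "\<not> handle d b" "\<not> below d b" "d \<noteq> Sigma i" for i
      using assms ab by (cases a; cases b; cases d; auto simp: handle_pair_iff)+
    then show ?thesis using a ab 8 by (simp add: defs)
  next
    case 9
    have "below d b \<Longrightarrow> below d a"
      using assms by (cases a; cases b; cases d; auto)
    then show ?thesis using a ab 9 by (auto simp add: defs)
  qed (use a ab in \<open>simp_all add: defs\<close>)
qed

lemma act_rel_handle:
  assumes "loop a" "loop b" "handle b a"
  shows "act (sg' 1 @ [(b, True)] @ sg' 1 @ [(a, True)]) g = act ([(a, True)] @ sg' 1 @ [(b, True)] @ sg 1) g"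
    (is "?l = ?r")
proof
  fix d
  have a: "a \<noteq> Sigma i" "Sigma i \<noteq> a" "b \<noteq> Sigma i" "Sigma i \<noteq> b" for i using assms by (auto simp: loop_def)
  note defs = act_Cons gen_act_loop assms loop_act_def braid_act_inv_def braid_act_def Let_def mult.assoc numeral_2_eq_2
  have ab: "a \<noteq> b" "b \<noteq> a" "\<not> below a b" "below b a" "\<not> handle a b"
    using assms(3) by (cases a; cases b; auto simp: handle_pair_iff)+
  consider "d = Sigma 1" | "d = Sigma 2" | "d = a" | "d = b"
    | "d \<noteq> Sigma 1" "d \<noteq> Sigma 2" "d \<noteq> a" "d \<noteq> b" 
    by blast
  then show "?l d = ?r d"
  proof cases
    case 5
    \<comment> \<open>The two loops of a handle are consecutive and have no other partners, so any
      other index lies on the same side of both.\<close>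
    have h: "\<not> handle d a" "\<not> handle a d" "\<not> handle d b" "\<not> handle b d" "below d b \<longleftrightarrow> below d a"
      using assms 5 by (cases a; cases b; cases d; auto simp: handle_pair_iff)+
    then show ?thesis using a ab 5 by (simp add: defs)
  qed (use a ab in \<open>simp_all add: defs\<close>)
qed

lemma act_rel_braid:
  "act (sg i @ sg (i+1) @ sg i) g = act (sg (i+1) @ sg i @ sg (i+1)) g"
  by (auto simp: act_Cons braid_act_def fun_eq_iff mult.assoc)

lemma act_rel_far:
  "i + 1 < j \<or> j + 1 < i \<Longrightarrow> act (sg i @ sg j) g = act (sg j @ sg i) g"
  by (auto simp: act_Cons braid_act_def fun_eq_iff mult.assoc)

lemma act_rel_loop:
  assumes "loop a" "1 < i"
  shows "act ([(a, True)] @ sg i) g = act (sg i @ [(a, True)]) g"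
proof -
  have "a \<noteq> Sigma i" "Sigma i \<noteq> a" for i using assms by (auto simp: loop_def)
  then show ?thesis
    using assms
    by (auto simp: act_Cons gen_act_loop braid_act_def loop_act_def Let_def fun_eq_iff)
qed

lemma act_rel:
  assumes "(l, r) \<in> sb_rels n g p"
  shows "act l f = act r f"
proof -
  have handle: "1 \<le> m \<Longrightarrow> handle (X (2 * m - 1)) (X (2 * m))" for m
    by (auto simp: handle_pair_def)
  show ?thesis
    using assms unfolding sb_rels_def
    apply (elim UnE CollectE exE conjE Pair_inject; hypsubst)
    subgoal by (rule act_rel_braid)
    subgoal by (rule act_rel_far)
    subgoal by (rule act_rel_loop) auto
    subgoal by (rule act_rel_loop) auto
    subgoal by (rule act_rel_loop_self) auto
    subgoal by (rule act_rel_below) auto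
    subgoal by (rule act_rel_handle) (simp_all only: handle loop_Sigma atLeastAtMost_iff)
    subgoal by (rule act_rel_below) auto
    subgoal by (rule act_rel_below) auto
    subgoal by (rule act_rel_loop_self) auto
    done
qed

lemma act_pres_eq:
  assumes "pres_eq (sb_gens n g p) (sb_rels n g p) u v"
  shows "act u f = act v f"
proof -
  have "ev gen_sym u = (ev gen_sym v :: (sbgen \<Rightarrow> 'a) sym)"
    using assms by (rule ev_pres_eq) (metis act_def act_rel sym_eqI)
  then show ?thesis
    by (simp add: act_def)
qed

text \<open>Generators act by group words in the entries. With \<open>S\<close> the image of
  \<open>U\<close>, this yields normality of \<open>U\<close> under the smaller braid group.\<close>

lemma act_closed:
  assumes "1 \<in> S" "\<And>x y. x \<in> S \<Longrightarrow> y \<in> S \<Longrightarrow> x * y \<in> S" "\<And>x. x \<in> S \<Longrightarrow> x\<^sup>- \<in> S"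
    and "\<And>d. f d \<in> S"
  shows "act w f d \<in> S"
proof (induction w arbitrary: d)
  case Nil
  then show ?case using assms by simp
next
  case (Cons l w)
  obtain s e where l: "l = (s, e)" by (cases l)
  show ?case
    using Cons.IH assms(1-3) unfolding l
    by (cases s; cases e)
      (simp_all add: act_Cons braid_act_def braid_act_inv_def loop_act_def loop_act_inv_def Let_def)
qed

section \<open>Naturality and locality of the action\<close>

definition mult_hom :: "('a::mult_group \<Rightarrow> 'b::mult_group) \<Rightarrow> bool" where
  "mult_hom h \<longleftrightarrow> (\<forall>x y. h (x * y) = h x * h y)"

lemma mult_hom_mult: "mult_hom h \<Longrightarrow> h (x * y) = h x * h y"
  by (simp add: mult_hom_def)

lemma mult_hom_one: "mult_hom h \<Longrightarrow> h 1 = 1"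
  using mult_hom_mult[of h 1 1] by (metis mult_1_right mult_left_cancel_iff)

lemma mult_hom_ginv: "mult_hom h \<Longrightarrow> h (x\<^sup>-) = (h x)\<^sup>-"
  using mult_hom_mult[of h x "x\<^sup>-"] by (simp add: mult_hom_one ginv_unique)

text \<open>Homomorphisms commute with the group words by which generators act. The lemma serves for
  the projection and embedding of the wreath product and for conjugations.\<close>

lemma act_natural:
  assumes "mult_hom h"
  shows "act w (\<lambda>d. h (f d)) = (\<lambda>d. h (act w f d))"
proof (induction w)
  case Nil
  then show ?case by simp
next
  case (Cons l w)
  obtain s e where l: "l = (s, e)" by (cases l)
  show ?case
    unfolding l using assms
    by (cases s; cases e)
      (auto simp add: act_Cons Cons.IH braid_act_def braid_act_inv_def loop_act_def loop_act_inv_def Let_def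
        mult_hom_mult mult_hom_ginv fun_eq_iff)
qed

text \<open>A braid generator \<open>Sigma i\<close> with i < m involves only the entries at i and i
  + 1, and a loop involves \<open>Sigma 1\<close> but no later strand. Hence the entry at
  \<open>Sigma k\<close> with k > m is neither changed nor read.\<close>

lemma act_upd_strand:
  assumes "w \<in> words (sb_gens m g p)" "1 \<le> m" "m < k"
  shows "act w (f(Sigma k := x)) = (act w f)(Sigma k := x)"
  using assms(1)
proof (induction w)
  case Nil
  then show ?case by simp
next
  case (Cons l w)
  obtain s e where l: "l = (s, e)" by (cases l)
  show ?case
    using Cons assms(2,3) unfolding l
    by (cases s; cases e)
      (auto simp add: act_Cons sb_gens_def braid_act_def braid_act_inv_def loop_act_def loop_act_inv_def Let_def
        fun_eq_iff)
qed

lemma act_other_strand: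
  assumes "w \<in> words (sb_gens m g p)" "1 \<le> m" "m < k"
  shows "act w f (Sigma k) = f (Sigma k)"
  using act_upd_strand[OF assms, of f "f (Sigma k)"] by (metis fun_upd_same fun_upd_triv)

section \<open>Pushing the last strand\<close>

lemma sg_down_Nil [simp]: "m \<le> Suc k \<Longrightarrow> sg_down m k = []"
  by (simp add: sg_down_def)

lemma sg_down_Suc: "k < m \<Longrightarrow> sg_down (Suc m) k = (Sigma m, True) # sg_down m k"
  by (simp add: sg_down_def)

lemma sg_down_snoc: "Suc k < m \<Longrightarrow> sg_down m k = sg_down m (Suc k) @ sg (Suc k)"
  by (simp add: sg_down_def upt_conv_Cons)

lemma sg_down_words: "m \<le> n \<Longrightarrow> sg_down m k \<in> words (sb_gens n g p)"
  by (auto simp: sg_down_def words_def sb_gens_def)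

lemma act_sg_down_last: "k < m \<Longrightarrow> act (sg_down m k) f (Sigma m) = f (Sigma (Suc k))"
proof (induction m)
  case (Suc m)
  then show ?case
    by (cases "k = m") (simp_all add: sg_down_Suc act_Cons braid_act_def)
qed simp

lemma act_sg_down_other:
  assumes "\<And>i. Suc k \<le> i \<Longrightarrow> i \<le> m \<Longrightarrow> d \<noteq> Sigma i"
  shows "act (sg_down m k) f d = f d"
  using assms
proof (induction m)
  case (Suc m)
  then show ?case
    by (cases "k < m") (simp_all add: sg_down_Suc act_Cons braid_act_def)
qed simp

lemma act_sg_down_inv:
  shows "k < m \<Longrightarrow> act (winv (sg_down m k)) f (Sigma (Suc k)) = f (Sigma m)"
    and "(\<And>i. Suc k \<le> i \<Longrightarrow> i \<le> m \<Longrightarrow> d \<noteq> Sigma i) \<Longrightarrow> act (winv (sg_down m k)) f d = f d"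
  using act_sg_down_last[of k m "act (winv (sg_down m k)) f"]
    act_sg_down_other[of k m d "act (winv (sg_down m k)) f"] by simp_all

text \<open>
  The set \<^const>\<open>sb_gens\<close> also indexes the generators of \<open>U\<close>: a word over it, read through
  \<open>U_gen\<close>, is an element of \<open>U\<close>.
\<close>

definition U_gen :: "nat \<Rightarrow> sbgen \<Rightarrow> sbgen word" where
  "U_gen m d = (case d of Sigma k \<Rightarrow> tau m k | X r \<Rightarrow> w_gen m r | Z j \<Rightarrow> xi m j)"

lemma U_gen_simps:
  "U_gen m (Sigma k) = sg_down m k @ sg k @ sg k @ winv (sg_down m k)"
  "loop a \<Longrightarrow> U_gen m a = sg_down m 0 @ [(a, True)] @ winv (sg_down m 0)"
  by (cases a; simp add: U_gen_def tau_def w_gen_def xi_def)+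

lemma U_gen_words: "d \<in> sb_gens m g p \<Longrightarrow> U_gen m d \<in> words (sb_gens m g p)"
  by (cases d) (simp_all add: U_gen_simps sg_down_words)

fun U_word :: "nat \<Rightarrow> sbgen word \<Rightarrow> sbgen word" where
  "U_word m [] = []"
| "U_word m ((d, e) # v) = (if e then U_gen m d else winv (U_gen m d)) @ U_word m v"

lemma U_word_words: "v \<in> words (sb_gens m g p) \<Longrightarrow> U_word m v \<in> words (sb_gens m g p)"
  by (induction m v rule: U_word.induct) (auto simp: U_gen_words)

lemma ev_U_word: "ev f (U_word m v) = ev (\<lambda>d. ev f (U_gen m d)) v"
  by (induction m v rule: U_word.induct) auto

section \<open>Effect of the generators of \<open>U\<close> on the last entry\<close>

lemma act_U_gen:
  "act (U_gen m (Sigma k)) f = act (sg_down m k) (braid_act k (braid_act k (act (winv (sg_down m k)) f)))"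
  "loop a \<Longrightarrow> act (U_gen m a) f = act (sg_down m 0) (loop_act a (act (winv (sg_down m 0)) f))"
  by (simp_all add: U_gen_simps act_Cons gen_act_loop)

text \<open>The inverse of \<open>sg_down\<close> brings the last entry to the place where the
  middle part acts. If it is 1, a loop has t = c = 1, and a half twist merely swaps two entries, so
  the full twist is trivial.\<close>

lemma act_U_gen_fix:
  assumes "d \<in> sb_gens m g p" "1 \<le> m" "f (Sigma m) = 1"
  shows "act (U_gen m d) f = f"
proof (cases "loop d")
  case True
  have "loop_act d h = h" if "h (Sigma (Suc 0)) = 1" for h :: "sbgen \<Rightarrow> 'a"
    using that by (auto simp: loop_act_def Let_def)
  then show ?thesis
    using assms True by (simp add: act_U_gen act_sg_down_inv)
next
  case False
  then obtain k where k: "d = Sigma k" by (auto simp: loop_def)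
  then have km: "k < m" using assms by (auto simp: sb_gens_def)
  have "braid_act k (braid_act k h) = h" if "h (Sigma (Suc k)) = 1" for h :: "sbgen \<Rightarrow> 'a"
    using that by (auto simp: braid_act_def)
  then show ?thesis
    using assms k km by (simp add: act_U_gen act_sg_down_inv)
qed

lemma wr_top_hom: "mult_hom wr_top"
  by (simp add: mult_hom_def)

lemma act_U_word_fix:
  assumes "v \<in> words (sb_gens m g p)" "1 \<le> m" "f (Sigma m) = 1"
  shows "act (U_word m v) f = f"
  using assms(1)
proof (induction v)
  case Nil
  then show ?case by simp
next
  case (Cons l v)
  obtain d e where l: "l = (d, e)" by (cases l)
  have d: "d \<in> sb_gens m g p" and IH: "act (U_word m v) f = f"
    using Cons l by auto
  then show ?case
    using act_U_gen_fix[where f = f, OF d assms(2,3)] act_winv(1)[of "U_gen m d" f] by (simp add: l)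
qed

text \<open>Projection to the tops makes the last entry 1, so \<open>act_U_word_fix\<close> applies
  to the projected tuple.\<close>

lemma act_U_word_top:
  assumes "v \<in> words (sb_gens m g p)" "1 \<le> m" "wr_top (f (Sigma m)) = 1"
  shows "wr_top (act (U_word m v) f d) = wr_top (f d)"
  using act_U_word_fix[OF assms(1,2), of "\<lambda>d. wr_top (f d)"] assms(3)
  by (simp add: act_natural wr_top_hom fun_eq_iff)

lemma act_U_gen_last:
  assumes "d \<in> sb_gens m g p" "1 \<le> m" "wr_top (f (Sigma m)) = 1"
  shows "act (U_gen m d) f (Sigma m) = f d * f (Sigma m) * (f d)\<^sup>-"
proof (cases "loop d")
  case True
  define h where "h = act (winv (sg_down m 0)) f"
  have d: "d \<noteq> Sigma i" for i using True by (auto simp: loop_def)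
  have h: "h (Sigma (Suc 0)) = f (Sigma m)" "h d = f d"
    using assms d by (simp_all add: h_def act_sg_down_inv)
  \<comment> \<open>For last entry t and loop entry a, the formula gives t^-1 (a t a^-1) t. Both t
    and its conjugate lie in the abelian base group, so the outer factors cancel.\<close>
  have "(f d * f (Sigma m) * (f d)\<^sup>-) * f (Sigma m) = f (Sigma m) * (f d * f (Sigma m) * (f d)\<^sup>-)"
    by (rule wr_base_commute) (simp_all add: assms)
  then have "loop_act d h (Sigma (Suc 0)) = f d * f (Sigma m) * (f d)\<^sup>-"
    using d by (simp add: loop_act_def Let_def h mult.assoc)
  then show ?thesis
    using assms True by (simp add: act_U_gen act_sg_down_last flip: h_def)
next
  case False
  then obtain k where k: "d = Sigma k" by (auto simp: loop_def)
  then have km: "k < m" using assms by (auto simp: sb_gens_def)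
  define h where "h = act (winv (sg_down m k)) f"
  have h: "h (Sigma (Suc k)) = f (Sigma m)" "h (Sigma k) = f (Sigma k)"
    using km by (simp_all add: h_def act_sg_down_inv)
  then have "braid_act k (braid_act k h) (Sigma (Suc k)) = f d * f (Sigma m) * (f d)\<^sup>-"
    using k by (simp add: braid_act_def)
  then show ?thesis
    using km k by (simp add: act_U_gen act_sg_down_last flip: h_def)
qed

text \<open>Later letters see changed entries, but their tops are unchanged and only tops matter
  when conjugating base elements. So each conjugator may be replaced by the original entry, and the
  conjugators multiply to \<open>ev f v\<close>.\<close>

lemma act_U_word_last:
  fixes f :: "sbgen \<Rightarrow> 'a::mult_group wr"
  assumes "v \<in> words (sb_gens m g p)" "1 \<le> m" "wr_top (f (Sigma m)) = 1"
  shows "act (U_word m v) f (Sigma m) = ev f v * f (Sigma m) * (ev f v)\<^sup>-"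
  using assms(1)
proof (induction v)
  case Nil
  then show ?case by simp
next
  case (Cons l v)
  obtain d e where l: "l = (d, e)" by (cases l)
  have d: "d \<in> sb_gens m g p" and v: "v \<in> words (sb_gens m g p)"
    using Cons l by auto
  define h where "h = act (U_word m v) f"
  have h: "wr_top (h c) = wr_top (f c)" for c
    unfolding h_def by (rule act_U_word_top[where f = f, OF v assms(2,3)])
  have hm: "h (Sigma m) = ev f v * f (Sigma m) * (ev f v)\<^sup>-"
    using Cons.IH[OF v] by (simp add: h_def)
  show ?case
  proof (cases e)
    case True
    have "act (U_gen m d) h (Sigma m) = h d * h (Sigma m) * (h d)\<^sup>-"
      by (rule act_U_gen_last[OF d assms(2)]) (simp add: h assms)
    also have "\<dots> = f d * h (Sigma m) * (f d)\<^sup>-"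
      by (rule wr_base_conj) (simp_all add: h assms)
    finally show ?thesis
      using True by (simp add: l hm mult.assoc flip: h_def)
  next
    case False
    define k where "k = act (winv (U_gen m d)) h"
    have hk: "h = act (U_gen m d) k"
      by (simp add: k_def)
    have k: "wr_top (k c) = wr_top (h c)" for c
      using act_U_word_top[of "[(d, False)]" m g p h c] d assms h by (simp add: k_def)
    have "h (Sigma m) = k d * k (Sigma m) * (k d)\<^sup>-"
      unfolding hk by (rule act_U_gen_last[OF d assms(2)]) (simp add: k h assms)
    also have "\<dots> = f d * k (Sigma m) * (f d)\<^sup>-"
      by (rule wr_base_conj) (simp_all add: h k assms)
    finally have "k (Sigma m) = (f d)\<^sup>- * h (Sigma m) * f d"
      by (simp add: mult.assoc)
    then show ?thesis
      using False by (simp add: l hm mult.assoc k_def flip: h_def)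
  qed
qed

text \<open>A generic test tuple: by \<open>wr_conj_point\<close>, a conjugate of its last entry
  determines the top of the conjugator.\<close>

definition wr_tuple :: "nat \<Rightarrow> (sbgen \<Rightarrow> 'a::mult_group) \<Rightarrow> sbgen \<Rightarrow> 'a wr" where
  "wr_tuple m f = (\<lambda>d. Wr {} (f d))(Sigma m := Wr {1} 1)"

lemma Wr_hom: "mult_hom (Wr {})"
  by (simp add: mult_hom_def times_wr_def)

lemma wr_top_ev: "wr_top (ev f v) = ev (\<lambda>d. wr_top (f d)) v"
  by (induction f v rule: ev.induct) auto

lemma ev_cong:
  assumes "v \<in> words S" "\<And>d. d \<in> S \<Longrightarrow> f d = h d"
  shows "ev f v = ev h v"
  using assms(1)
proof (induction v)
  case (Cons l v)
  then show ?case by (cases l) (simp add: assms(2))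
qed simp

lemma U_word_faithful:
  fixes f :: "sbgen \<Rightarrow> 'a::mult_group"
  assumes "v \<in> words (sb_gens m g p)" "1 \<le> m"
    and "\<And>h :: sbgen \<Rightarrow> 'a wr. act (U_word m v) h (Sigma m) = h (Sigma m)"
  shows "ev f v = 1"
proof -
  let ?h = "wr_tuple m f"
  have "ev ?h v * Wr {1} 1 * (ev ?h v)\<^sup>- = 1 * Wr {1} 1 * 1\<^sup>-"
    using act_U_word_last[OF assms(1,2), of ?h] by (simp add: assms(3)) (simp add: wr_tuple_def)
  then have "wr_top (ev ?h v) = 1"
    by (metis wr_conj_point wr_top_simps(1))
  \<comment> \<open>The index \<open>Sigma m\<close> lies outside \<open>sb_gens m g p\<close>, so
    \<open>v\<close> never reads the altered entry.\<close>
  moreover have "ev (\<lambda>d. wr_top (?h d)) v = ev f v"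
    by (rule ev_cong[OF assms(1)]) (auto simp: wr_tuple_def sb_gens_def)
  ultimately show ?thesis
    by (simp add: wr_top_ev)
qed

section \<open>Conjugation on U in representations of the surface braid group\<close>

lemma mult_eq_assoc: "x * y = w \<Longrightarrow> x * (y * z) = w * (z :: 'a::mult_group)"
  by (simp flip: mult.assoc)

lemma intertwine_ginv:
  fixes x y z :: "'a::mult_group"
  assumes "x * y = z * x"
  shows "x * y\<^sup>- = z\<^sup>- * x" "x\<^sup>- * z = y * x\<^sup>-"
proof -
  have "z\<^sup>- * (z * x) * y\<^sup>- = z\<^sup>- * (x * y) * y\<^sup>-" "x\<^sup>- * (z * x) * x\<^sup>- = x\<^sup>- * (x * y) * x\<^sup>-"
    by (simp_all only: assms)
  then show "x * y\<^sup>- = z\<^sup>- * x" "x\<^sup>- * z = y * x\<^sup>-"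
    by (simp_all add: mult.assoc)
qed

lemma conj_eq_iff:
  fixes x y z :: "'a::mult_group"
  shows "x\<^sup>- * y * x = z \<longleftrightarrow> y * x = x * z"
  using mult_left_cancel_iff[of x "x\<^sup>- * y * x" z] by (simp add: mult.assoc)

lemma mult_hom_conj: "mult_hom (\<lambda>x. y\<^sup>- * x * y)" "mult_hom (\<lambda>x. y * x * y\<^sup>-)"
  by (simp_all add: mult_hom_def mult.assoc)

lemma Sigma_in_sb_gens [simp]: "Sigma i \<in> sb_gens n g p \<longleftrightarrow> 1 \<le> i \<and> i < n"
  by (auto simp: sb_gens_def)

text \<open>A representation of the n-strand group in an arbitrary group. Calculations are done here
  and later specialised to the regular representation, where they become statements about
  braids.\<close>

locale sb_rep =
  fixes n g p :: nat and f :: "sbgen \<Rightarrow> 'a::mult_group"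
  assumes rel: "(l, r) \<in> sb_rels n g p \<Longrightarrow> l \<in> words (sb_gens n g p) \<Longrightarrow>
    r \<in> words (sb_gens n g p) \<Longrightarrow> ev f l = ev f r"
begin

abbreviation s :: "nat \<Rightarrow> 'a" where "s i \<equiv> f (Sigma i)"

definition loops :: "sbgen set" where "loops = X ` {1..2*g} \<union> Z ` {1..<p}"

lemma braid:
  assumes "1 \<le> i" "Suc i < n"
  shows "s i * (s (Suc i) * s i) = s (Suc i) * (s i * s (Suc i))"
  using rel[of "sg i @ sg (i+1) @ sg i" "sg (i+1) @ sg i @ sg (i+1)"] assms
  by (auto simp: sb_rels_def sb_gens_def)

lemma far:
  assumes "1 \<le> i" "i < n" "1 \<le> j" "j < n" "Suc i < j \<or> Suc j < i"
  shows "s i * s j = s j * s i"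
  using rel[of "sg i @ sg j" "sg j @ sg i"] assms
  by (auto simp: sb_rels_def sb_gens_def)

lemma loop_far:
  assumes "a \<in> loops" "1 < i" "i < n"
  shows "f a * s i = s i * f a"
  using rel[of "[(a, True)] @ sg i" "sg i @ [(a, True)]"] assms
  by (auto simp: sb_rels_def sb_gens_def loops_def)

lemma loop_self:
  assumes "a \<in> loops" "2 \<le> n"
  shows "(s 1)\<^sup>- * (f a * ((s 1)\<^sup>- * f a)) = f a * ((s 1)\<^sup>- * (f a * (s 1)\<^sup>-))"
  using rel[of "sg' 1 @ [(a, True)] @ sg' 1 @ [(a, True)]" "[(a, True)] @ sg' 1 @ [(a, True)] @ sg' 1"] assms
  by (auto simp: sb_rels_def sb_gens_def loops_def)

lemma loop_below:
  assumes "a \<in> loops" "b \<in> loops" "below b a" "\<not> handle b a" "2 \<le> n"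
  shows "(s 1)\<^sup>- * (f b * (s 1 * f a)) = f a * ((s 1)\<^sup>- * (f b * s 1))"
  using rel[of "sg' 1 @ [(b, True)] @ sg 1 @ [(a, True)]" "[(a, True)] @ sg' 1 @ [(b, True)] @ sg 1"] assms
  by (auto simp: sb_rels_def sb_gens_def loops_def)

lemma loop_handle:
  assumes "a \<in> loops" "b \<in> loops" "handle b a" "2 \<le> n"
  shows "(s 1)\<^sup>- * (f b * ((s 1)\<^sup>- * f a)) = f a * ((s 1)\<^sup>- * (f b * s 1))"
proof -
  obtain m where m: "a = X (2 * m)" "b = X (2 * m - 1)" "1 \<le> m" "m \<le> g"
    using assms by (auto simp: loops_def handle_pair_def)
  then show ?thesis
    using rel[of "sg' 1 @ xg (2*m-1) @ sg' 1 @ xg (2*m)" "xg (2*m) @ sg' 1 @ xg (2*m-1) @ sg 1"] assms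
    by (auto simp: sb_rels_def sb_gens_def loops_def)
qed

section \<open>Moving generators through a descending product\<close>

definition D :: "nat \<Rightarrow> nat \<Rightarrow> 'a" where "D m k = ev f (sg_down m k)"

lemma D_triv [simp]: "m \<le> Suc k \<Longrightarrow> D m k = 1"
  by (simp add: D_def)

lemma D_Suc: "k < m \<Longrightarrow> D (Suc m) k = s m * D m k"
  by (simp add: D_def sg_down_Suc)

lemma D_snoc: "Suc k < m \<Longrightarrow> D m k = D m (Suc k) * s (Suc k)"
  by (simp add: D_def sg_down_snoc)

lemma D_split: "k < l \<Longrightarrow> l < m \<Longrightarrow> D m k = D m l * (s l * D l k)"
proof (induction m)
  case (Suc m)
  then show ?case
    by (cases "l = m") (simp_all add: D_Suc mult.assoc)
qed simp

lemma D_commute_high: "m < j \<Longrightarrow> j < n \<Longrightarrow> D m k * s j = s j * D m k"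
proof (induction m)
  case (Suc m)
  show ?case
  proof (cases "k < m")
    case True
    have c: "s m * s j = s j * s m" using Suc True by (intro far) auto
    show ?thesis
      using Suc True c mult_eq_assoc[OF c] by (simp add: D_Suc mult.assoc)
  qed simp
qed simp

lemma D_commute_low: "1 \<le> j \<Longrightarrow> j < k \<Longrightarrow> m \<le> n \<Longrightarrow> D m k * s j = s j * D m k"
proof (induction m)
  case (Suc m)
  show ?case
  proof (cases "k < m")
    case True
    have c: "s m * s j = s j * s m" using Suc True by (intro far) auto
    show ?thesis
      using Suc True c mult_eq_assoc[OF c] by (simp add: D_Suc mult.assoc)
  qed simp
qed simp

lemma D_commute_loop: "a \<in> loops \<Longrightarrow> 1 \<le> k \<Longrightarrow> m \<le> n \<Longrightarrow> D m k * f a = f a * D m k"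
proof (induction m)
  case (Suc m)
  show ?case
  proof (cases "k < m")
    case True
    have c: "s m * f a = f a * s m" using Suc True by (intro loop_far[symmetric]) auto
    show ?thesis
      using Suc True c mult_eq_assoc[OF c] by (simp add: D_Suc mult.assoc)
  qed simp
qed simp

text \<open>Moving \<open>s (Suc i)\<close> from right to left, the factors below \<open>s i\<close>
  commute with it, the pair \<open>s (Suc i) * s i\<close> turns it into \<open>s i\<close> by the
  braid relation, and the higher factors commute with \<open>s i\<close>.\<close>

lemma D_shift: "k < i \<Longrightarrow> Suc i < m \<Longrightarrow> m \<le> n \<Longrightarrow> D m k * s (Suc i) = s i * D m k"
proof (induction m)
  case (Suc m)
  show ?case
  proof (cases "m = Suc i")
    case True
    have "D i k * s (Suc i) = s (Suc i) * D i k"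
      using Suc.prems True by (intro D_commute_high) auto
    moreover have "s (Suc i) * (s i * (s (Suc i) * z)) = s i * (s (Suc i) * (s i * z))" for z
      using arg_cong[OF braid[of i], of "\<lambda>x. x * z"] Suc.prems True by (simp add: mult.assoc)
    ultimately show ?thesis
      using Suc.prems True by (simp add: D_Suc mult.assoc)
  next
    case False
    have c: "s m * s i = s i * s m" using Suc.prems False by (intro far) auto
    show ?thesis
      using Suc False c mult_eq_assoc[OF c] by (simp add: D_Suc mult.assoc)
  qed
qed simp

text \<open>
  Conjugated by \<open>s (n-1) \<cdots> s 1\<close>, the generators of \<open>U\<close> describe the motions of the first strand:
  the loops become the standard generators and \<open>B (n-1)\<close> acts through the remaining strands.
\<close>

definition first_tau :: "nat \<Rightarrow> 'a" where
  "first_tau k = (D k 0)\<^sup>- * (s k * (s k * D k 0))"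

definition first_gens :: "sbgen \<Rightarrow> 'a" where
  "first_gens d = (case d of Sigma k \<Rightarrow> (if 1 \<le> k \<and> k < n then first_tau k else 1)
     | _ \<Rightarrow> (if d \<in> loops then f d else 1))"

text \<open>The conjugate of \<open>f c\<close> by \<open>D n 0\<close>, as \<open>D_shifted\<close>
  shows: braid generators shift by one strand, and for a loop only the factor \<open>s 1\<close>
  matters, since loops commute with the other factors.\<close>

definition shifted :: "sbgen \<Rightarrow> 'a" where
  "shifted c = (case c of Sigma i \<Rightarrow> s (Suc i) | _ \<Rightarrow> (s 1)\<^sup>- * (f c * s 1))"

lemma loops_loop: "a \<in> loops \<Longrightarrow> loop a"
  by (auto simp: loops_def)

lemma first_gens_loop:
  "loop a \<Longrightarrow> first_gens a = (if a \<in> loops then f a else 1)"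
  "loop a \<Longrightarrow> shifted a = (s 1)\<^sup>- * (f a * s 1)"
  by (cases a; simp add: first_gens_def shifted_def)+

lemma first_gens_outside: "d \<notin> sb_gens n g p \<Longrightarrow> first_gens d = 1"
  by (cases d) (auto simp: first_gens_def sb_gens_def loops_def)

lemma loops_cases:
  assumes "c \<in> loops" "d \<in> loops" "d \<noteq> c"
  obtains "handle d c" | "handle c d" | "below d c" "\<not> handle d c" "\<not> handle c d"
    | "below c d" "\<not> handle c d" "\<not> handle d c" "\<not> below d c"
proof -
  have "below d c \<or> below c d"
    using assms by (cases c; cases d) (auto simp: loops_def)
  then show thesis
    using that by blast
qed

lemma handle_loops:
  assumes "c \<in> loops" "handle d c \<or> handle c d"
  shows "d \<in> loops"
proof -
  obtain r q where rq: "c = X r" "d = X q" "1 \<le> r" "r \<le> 2 * g" "handle_pair q r \<or> handle_pair r q"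
    using assms by (cases c; cases d) (auto simp: loops_def)
  from this(3-5) have "1 \<le> q \<and> q \<le> 2 * g"
    unfolding handle_pair_iff by presburger
  then show ?thesis
    by (simp add: rq loops_def)
qed

lemma first_tau_commute:
  assumes "1 \<le> k" "k < n" "1 \<le> i" "Suc i < n" "k \<noteq> i" "k \<noteq> Suc i"
  shows "first_tau k * s (Suc i) = s (Suc i) * first_tau k"
proof -
  consider "k < i" | "Suc i < k" using assms by linarith
  then show ?thesis
  proof cases
    case 1
    have D: "D k 0 * s (Suc i) = s (Suc i) * D k 0" using 1 assms by (intro D_commute_high) auto
    have s: "s k * s (Suc i) = s (Suc i) * s k" using 1 assms by (intro far) auto
    show ?thesis
      using D mult_eq_assoc[OF intertwine_ginv(2)[OF D]] s mult_eq_assoc[OF s]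
      by (simp add: first_tau_def mult.assoc)
  next
    case 2
    have D: "D k 0 * s (Suc i) = s i * D k 0" using 2 assms by (intro D_shift) auto
    have s: "s k * s i = s i * s k" using 2 assms by (intro far) auto
    show ?thesis
      using D mult_eq_assoc[OF intertwine_ginv(2)[OF D]] s mult_eq_assoc[OF s]
      by (simp add: first_tau_def mult.assoc)
  qed
qed

text \<open>The factor \<open>D i 0\<close> commutes with \<open>s (Suc i)\<close>, so both claims
  reduce to identities in the three-strand braid group; the second says that b commutes with a b^2
  a.\<close>

lemma
  assumes "1 \<le> i" "Suc i < n"
  shows first_tau_Suc_conj: "first_tau (Suc i) * s (Suc i) = s (Suc i) * first_tau i"
    and first_tau_prod_commute:
      "first_tau i * first_tau (Suc i) * s (Suc i) = s (Suc i) * (first_tau i * first_tau (Suc i))"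
proof -
  define A a b where ab: "A = D i 0" "a = s i" "b = s (Suc i)"
  have br: "b * (a * b) = a * (b * a)" using braid[OF assms] by (simp add: ab)
  have br': "b * (a * (b * z)) = a * (b * (a * z))" for z
    using arg_cong[OF br, of "\<lambda>x. x * z"] by (simp add: mult.assoc)
  have A: "A * b = b * A" unfolding ab using assms by (intro D_commute_high) auto
  note A = this mult_eq_assoc[OF this] intertwine_ginv(2)[OF this] mult_eq_assoc[OF intertwine_ginv(2)[OF this]]
  have "a\<^sup>- * (b * (b * (a * (b * z)))) = b * (a * (a * z))" for z
    by (simp add: br')
  then show "first_tau (Suc i) * s (Suc i) = s (Suc i) * first_tau i"
    using assms by (simp add: first_tau_def D_Suc mult.assoc A flip: ab)
  have "a * (b * (b * (a * (b * z)))) = b * (a * (b * (b * (a * z))))" for z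
    by (simp add: br')
  then show "first_tau i * first_tau (Suc i) * s (Suc i) = s (Suc i) * (first_tau i * first_tau (Suc i))"
    using assms by (simp add: first_tau_def D_Suc mult.assoc A flip: ab)
qed

lemma first_tau_loop:
  assumes "a \<in> loops" "2 \<le> k" "k < n"
  shows "first_tau k * ((s 1)\<^sup>- * (f a * s 1)) = (s 1)\<^sup>- * (f a * s 1) * first_tau k"
proof -
  define C where "C = D k 1"
  have D: "D k 0 = C * s 1" using D_snoc[of 0 k] assms by (simp add: C_def)
  have "C * f a = f a * C" unfolding C_def using assms by (intro D_commute_loop) auto
  note C = this mult_eq_assoc[OF this] mult_eq_assoc[OF intertwine_ginv(2)[OF this]]
  have "s k * f a = f a * s k" using assms by (intro loop_far[symmetric]) auto
  with C mult_eq_assoc[OF this] show ?thesis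
    by (simp add: first_tau_def D mult.assoc)
qed

text \<open>This derives the explicit formulas of the conjugation action from the relations. In the
  picture of the first strand the loops are the generators \<open>f c\<close> themselves, so each
  case matches one defining relation.\<close>

lemma shifted_conj:
  assumes "c \<in> sb_gens (n - 1) g p" "2 \<le> n"
  shows "(shifted c)\<^sup>- * first_gens d * shifted c = gen_act c first_gens d"
proof (cases "loop c")
  case False
  then obtain i where c: "c = Sigma i" by (auto simp: loop_def)
  then have i: "1 \<le> i" "Suc i < n" using assms by (auto simp: sb_gens_def)
  have sh: "shifted c = s (Suc i)" by (simp add: c shifted_def)
  have fg: "first_gens (Sigma i) = first_tau i" "first_gens (Sigma (Suc i)) = first_tau (Suc i)"
    using i by (simp_all add: first_gens_def)
  consider "d = Sigma i" | "d = Sigma (Suc i)"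
    | k where "d = Sigma k" "k \<noteq> i" "k \<noteq> Suc i" "1 \<le> k" "k < n"
    | "d \<in> loops" "loop d" | "d \<notin> sb_gens n g p"
  proof -
    have "(\<exists>k. d = Sigma k \<and> 1 \<le> k \<and> k < n) \<or> d \<in> loops \<or> d \<notin> sb_gens n g p"
      by (auto simp: sb_gens_def loops_def)
    then show thesis
      using that loops_loop by blast
  qed
  then show ?thesis
  proof cases
    case 1
    \<comment> \<open>Conjugation by \<open>s (Suc i)\<close> fixes the product of the two elements
      and sends the second to the first, which determines the image of the first.\<close>
    have "first_tau i * s (Suc i) = s (Suc i) * (first_tau i * first_tau (Suc i) * (first_tau i)\<^sup>-)"
      using arg_cong[OF first_tau_prod_commute[OF i], of "\<lambda>x. x * (first_tau i)\<^sup>-"]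
        mult_eq_assoc[OF first_tau_Suc_conj[OF i]] by (simp add: mult.assoc)
    then show ?thesis
      by (simp add: 1 c braid_act_def fg conj_eq_iff sh[unfolded c])
  next
    case 2
    then show ?thesis
      using first_tau_Suc_conj[OF i] by (simp add: c braid_act_def fg conj_eq_iff sh[unfolded c])
  next
    case 3
    then show ?thesis
      using first_tau_commute[of k i] i
      by (simp add: c braid_act_def conj_eq_iff sh[unfolded c]) (simp add: first_gens_def)
  next
    case 4
    then show ?thesis
      using loop_far[of d "Suc i"] i
      by (auto simp add: c braid_act_def conj_eq_iff sh[unfolded c] first_gens_loop loop_def)
  next
    case 5
    then have "d \<noteq> Sigma i" "d \<noteq> Sigma (Suc i)"
      using i by (auto simp: sb_gens_def)
    then show ?thesis
      by (simp add: c braid_act_def first_gens_outside[OF 5])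
  qed
next
  case c: True
  then have cl: "c \<in> loops" using assms by (auto simp: sb_gens_def loops_def loop_def)
  \<comment> \<open>Here \<open>T\<close> and \<open>k\<close> are the values of t and c in
    \<open>loop_act\<close>, \<open>e\<close> is the conjugating element, and \<open>q\<close> is
    the conjugate of the loop by \<open>\<sigma>\<close> from the other side.\<close>
  define a \<sigma> where a\<sigma>: "a = f c" "\<sigma> = s 1"
  define e where "e = \<sigma>\<^sup>- * (a * \<sigma>)"
  define T where "T = \<sigma> * \<sigma>"
  define k where "k = T\<^sup>- * a * T * a\<^sup>-"
  define q where "q = \<sigma> * (a * \<sigma>\<^sup>-)"
  have self: "\<sigma>\<^sup>- * (a * (\<sigma>\<^sup>- * a)) = a * (\<sigma>\<^sup>- * (a * \<sigma>\<^sup>-))"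
    using loop_self[OF cl assms(2)] by (simp add: a\<sigma>)
  \<comment> \<open>The relation \<open>self\<close> says that this product commutes with the
    inverse of \<sigma>, hence with \<sigma>.\<close>
  have "(a * (\<sigma>\<^sup>- * a)) * \<sigma>\<^sup>- = \<sigma>\<^sup>- * (a * (\<sigma>\<^sup>- * a))"
    using self by (simp add: mult.assoc)
  from intertwine_ginv(1)[OF this] have qa: "a * e = q * a"
    by (simp add: e_def q_def mult.assoc)
  \<comment> \<open>This replaces the commutator \<open>k\<close> by e^-1 q, after which every case
    needs only simple relations with \<open>e\<close> and \<open>q\<close>.\<close>
  have ek: "e * k = q"
  proof -
    have "e * (k * a) = \<sigma>\<^sup>- * (a * (\<sigma>\<^sup>- * a)) * (\<sigma> * \<sigma>)"
      by (simp add: e_def k_def T_def mult.assoc)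
    also have "\<dots> = a * e"
      unfolding self by (simp add: e_def mult.assoc)
    finally show ?thesis
      using mult_right_cancel_iff[of "e * k" a q] qa by (simp add: mult.assoc)
  qed
  have Te: "T * e = q * T"
    by (simp add: T_def e_def q_def mult.assoc)
  have fg: "first_gens (Sigma 1) = T" "first_gens c = a" "shifted c = e"
    using assms cl first_gens_loop[OF c]
    by (simp_all add: first_gens_def[of "Sigma i" for i] first_tau_def T_def e_def a\<sigma>)
  have goal: "loop_act c first_gens d =
    (if d = Sigma 1 \<or> d = c then k * first_gens d
     else if handle d c then k * first_gens d * T
     else if handle c d then T\<^sup>- * first_gens d
     else if below d c then k * first_gens d * k\<^sup>-
     else first_gens d)" for d
    by (simp only: loop_act_def Let_def fg k_def)
  have gc: "gen_act c = loop_act c" using c by (rule gen_act_loop)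
  note red = conj_eq_iff fg gc goal
  consider "d = Sigma 1" | "d = c" | i where "d = Sigma i" "2 \<le> i" "i < n" 
    | "d \<notin> sb_gens n g p"
    | "d \<in> loops" "loop d" "handle d c" | "d \<in> loops" "loop d" "handle c d"
    | "d \<in> loops" "loop d" "below d c" "\<not> handle d c" "\<not> handle c d" "d \<noteq> c"
    | "d \<in> loops" "loop d" "below c d" "\<not> handle c d" "\<not> handle d c" "\<not> below d c" "d \<noteq> c"
  proof (cases "d \<in> loops \<and> d \<noteq> c")
    case True
    then show ?thesis
      using loops_cases[OF cl, of d] loops_loop[of d] that by blast
  next
    case False
    then show ?thesis
      using that(1-4) by (cases d) (fastforce simp: sb_gens_def loops_def)+
  qed
  then show ?thesis
  proof cases
    case 1
    then show ?thesis using Te mult_eq_assoc[OF ek, of T] by (simp add: red del: One_nat_def)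
  next
    case 2
    have "a * e = e * (k * a)" using qa mult_eq_assoc[OF ek] by simp
    then show ?thesis by (simp only: 2 red) simp
  next
    case 3
    then have "first_gens d * e = e * first_gens d"
      using first_tau_loop[OF cl, of i] by (simp add: first_gens_def e_def a\<sigma>)
    moreover have "Sigma i \<noteq> c" using c by auto
    ultimately show ?thesis using 3 by (simp add: red)
  next
    case 4
    \<comment> \<open>Handle partners of loops in range are in range, so \<open>d\<close> meets only
      branches that preserve the value 1.\<close>
    then have "d \<noteq> Sigma 1" "d \<noteq> c" "\<not> handle d c" "\<not> handle c d"
      using handle_loops[OF cl, of d] cl assms(2) by (auto simp: sb_gens_def loops_def)
    then show ?thesis by (simp add: goal gc first_gens_outside[OF 4])
  next
    case 5
    have *: "\<sigma>\<^sup>- * (f d * (\<sigma>\<^sup>- * a)) = a * (\<sigma>\<^sup>- * (f d * \<sigma>))"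
      using loop_handle[OF cl] 5 assms by (simp add: a\<sigma>)
    have "f d * e = \<sigma> * (\<sigma>\<^sup>- * (f d * (\<sigma>\<^sup>- * a))) * \<sigma>"
      by (simp add: e_def mult.assoc)
    also have "\<dots> = q * (f d * T)"
      unfolding * by (simp add: q_def T_def mult.assoc)
    finally have "f d * e = e * (k * (f d * T))"
      using mult_eq_assoc[OF ek] by simp
    moreover have "d \<noteq> Sigma 1" "d \<noteq> c" using 5 by auto
    ultimately show ?thesis using 5 by (simp add: red first_gens_loop mult.assoc)
  next
    case 6
    have "\<sigma>\<^sup>- * (a * (\<sigma>\<^sup>- * f d)) = f d * (\<sigma>\<^sup>- * (a * \<sigma>))"
      using loop_handle[of d c] cl 6 assms by (simp add: a\<sigma>)
    then have "f d * e = e * (T\<^sup>- * f d)"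
      by (simp add: e_def T_def mult.assoc)
    moreover have "d \<noteq> Sigma 1" "d \<noteq> c" "\<not> handle d c"
      using 6 by (auto simp: loops_def) (cases c; simp add: handle_pair_iff)
    ultimately show ?thesis using 6 by (simp add: red first_gens_loop)
  next
    case 7
    have *: "\<sigma>\<^sup>- * (f d * (\<sigma> * a)) = a * (\<sigma>\<^sup>- * (f d * \<sigma>))"
      using loop_below[of c d] cl 7 assms by (simp add: a\<sigma>)
    \<comment> \<open>The relation makes \<open>f d\<close> commute with q = e k; hence conjugating
      by \<open>e\<close> amounts to conjugating by k^-1.\<close>
    have "f d * q = \<sigma> * (\<sigma>\<^sup>- * (f d * (\<sigma> * a))) * \<sigma>\<^sup>-"
      by (simp add: q_def mult.assoc)
    also have "\<dots> = q * f d"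
      unfolding * by (simp add: q_def mult.assoc)
    finally have "f d * e * k = e * k * f d"
      by (simp add: ek mult.assoc)
    from arg_cong[OF this, of "\<lambda>x. x * k\<^sup>-"] have "f d * e = e * (k * f d * k\<^sup>-)"
      by (simp add: mult.assoc)
    moreover have "d \<noteq> Sigma 1" using 7 by auto
    ultimately show ?thesis using 7 by (simp add: red first_gens_loop)
  next
    case 8
    have "\<sigma>\<^sup>- * (a * (\<sigma> * f d)) = f d * (\<sigma>\<^sup>- * (a * \<sigma>))"
      using loop_below[of d c] cl 8 assms by (simp add: a\<sigma>)
    then have "f d * e = e * f d"
      by (simp add: e_def mult.assoc)
    moreover have "d \<noteq> Sigma 1" using 8 by auto
    ultimately show ?thesis using 8 by (simp add: red first_gens_loop)
  qed
qed


text \<open>With the value 1 outside the index set the conjugation formula holds at every index.\<close>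

definition U_elem :: "sbgen \<Rightarrow> 'a" where
  "U_elem d = (if d \<in> sb_gens n g p then ev f (U_gen n d) else 1)"

lemma U_elem_first_gens: "U_elem d = D n 0 * first_gens d * (D n 0)\<^sup>-"
proof (cases "d \<in> sb_gens n g p")
  case True
  show ?thesis
  proof (cases d)
    case (Sigma k)
    then have "1 \<le> k" "k < n" using True by (auto simp: sb_gens_def)
    then show ?thesis
      using True D_split[of 0 k n]
      by (simp add: U_elem_def Sigma U_gen_simps first_gens_def first_tau_def mult.assoc flip: D_def)
  qed (use True in \<open>auto simp: U_elem_def U_gen_simps first_gens_loop mult.assoc sb_gens_def loops_def simp flip: D_def\<close>)
next
  case False
  then show ?thesis by (simp add: U_elem_def first_gens_outside)
qed

lemma D_shifted:
  assumes "c \<in> sb_gens (n - 1) g p" "2 \<le> n"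
  shows "D n 0 * shifted c = f c * D n 0"
proof (cases "loop c")
  case True
  then have c: "c \<in> loops" using assms by (auto simp: sb_gens_def loops_def loop_def)
  have "D n 0 = D n 1 * s 1" using D_snoc[of 0 n] assms by simp
  moreover have "D n 1 * f c = f c * D n 1" using c by (intro D_commute_loop) auto
  from mult_eq_assoc[OF this, of "s 1"] have "D n 1 * (f c * s 1) = f c * (D n 1 * s 1)"
    by (simp add: mult.assoc)
  ultimately show ?thesis
    by (simp add: first_gens_loop True mult.assoc)
next
  case False
  then obtain i where i: "c = Sigma i" by (auto simp: loop_def)
  then have "0 < i" "Suc i < n" using assms by (auto simp: sb_gens_def)
  then show ?thesis using i D_shift[of 0 i n] by (simp add: shifted_def)
qed

lemma U_elem_conj_gen:
  assumes "c \<in> sb_gens (n - 1) g p" "2 \<le> n"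
  shows "(f c)\<^sup>- * U_elem d * f c = gen_act c U_elem d"
proof -
  let ?h = "\<lambda>x. D n 0 * x * (D n 0)\<^sup>-"
  have fc: "f c = ?h (shifted c)"
    using D_shifted[OF assms] by (simp add: mult.assoc)
  have U: "U_elem = (\<lambda>d. ?h (first_gens d))"
    by (rule ext) (rule U_elem_first_gens)
  have "gen_act c U_elem = (\<lambda>d. ?h (gen_act c first_gens d))"
    unfolding U using act_natural[OF mult_hom_conj(2), of "[(c, True)]"] by (simp add: act_Cons)
  then show ?thesis
    by (simp add: fc U_elem_first_gens mult.assoc flip: shifted_conj[OF assms])
qed

text \<open>Conjugation by \<open>ev f w\<close> is a homomorphism, so naturality moves it inside
  the action of the preceding letter. This reconciles the right action by conjugation with the left
  action on tuples.\<close>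

lemma U_elem_conj:
  assumes "w \<in> words (sb_gens (n - 1) g p)" "2 \<le> n"
  shows "(ev f w)\<^sup>- * U_elem d * ev f w = act w U_elem d"
  using assms(1)
proof (induction w arbitrary: d)
  case Nil
  then show ?case by simp
next
  case (Cons l w)
  obtain c e where l: "l = (c, e)" by (cases l)
  have c: "c \<in> sb_gens (n - 1) g p" and w: "w \<in> words (sb_gens (n - 1) g p)"
    using Cons.prems l by auto
  have letter: "(ev f [l])\<^sup>- * U_elem d * ev f [l] = act [l] U_elem d" for d
  proof (cases e)
    case True
    then show ?thesis
      using U_elem_conj_gen[OF c assms(2)] by (simp add: l act_Cons)
  next
    case False
    let ?k = "\<lambda>d. f c * U_elem d * (f c)\<^sup>-"
    have "act [(c, True)] ?k = (\<lambda>d. f c * act [(c, True)] U_elem d * (f c)\<^sup>-)"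
      by (rule act_natural[OF mult_hom_conj(2)])
    also have "\<dots> = U_elem"
      by (simp add: act_Cons mult.assoc flip: U_elem_conj_gen[OF c assms(2)])
    finally have "act (winv [(c, True)]) U_elem = ?k"
      by (metis act_winv(1))
    then show ?thesis
      using False by (simp add: l winv_def)
  qed
  have "(ev f (l # w))\<^sup>- * U_elem d * ev f (l # w) = (ev f w)\<^sup>- * ((ev f [l])\<^sup>- * U_elem d * ev f [l]) * ev f w"
    using ev_append[of f "[l]" w] by (simp add: mult.assoc)
  also have "\<dots> = act [l] (\<lambda>d. (ev f w)\<^sup>- * U_elem d * ev f w) d"
    unfolding letter act_natural[OF mult_hom_conj(1)] ..
  also have "\<dots> = act (l # w) U_elem d"
    by (simp only: Cons.IH[OF w] append.simps flip: act_append)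
  finally show ?case .
qed

section \<open>Normality of \<open>U\<close> and coset representatives\<close>

definition U_set :: "'a set" where
  "U_set = (\<lambda>v. ev f (U_word n v)) ` words (sb_gens n g p)"

lemma U_set_closed:
  "1 \<in> U_set" "x \<in> U_set \<Longrightarrow> y \<in> U_set \<Longrightarrow> x * y \<in> U_set" "x \<in> U_set \<Longrightarrow> x\<^sup>- \<in> U_set"
proof -
  show "1 \<in> U_set"
    unfolding U_set_def by (rule image_eqI[of _ _ "[]"]) auto
  show "x * y \<in> U_set" if xy: "x \<in> U_set" "y \<in> U_set"
  proof -
    obtain u v where "u \<in> words (sb_gens n g p)" "v \<in> words (sb_gens n g p)"
      "x = ev f (U_word n u)" "y = ev f (U_word n v)"
      using xy by (auto simp: U_set_def)
    then show ?thesis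
      unfolding U_set_def by (intro image_eqI[of _ _ "u @ v"]) (auto simp: ev_U_word)
  qed
  show "x\<^sup>- \<in> U_set" if x: "x \<in> U_set"
  proof -
    obtain u where "u \<in> words (sb_gens n g p)" "x = ev f (U_word n u)"
      using x by (auto simp: U_set_def)
    then show ?thesis
      unfolding U_set_def by (intro image_eqI[of _ _ "winv u"]) (auto simp: ev_U_word)
  qed
qed

lemma U_elem_in_U_set: "U_elem d \<in> U_set"
proof (cases "d \<in> sb_gens n g p")
  case True
  then show ?thesis
    unfolding U_set_def by (intro image_eqI[of _ _ "[(d, True)]"]) (auto simp: U_elem_def)
qed (simp add: U_elem_def U_set_closed)

text \<open>Applied to \<open>winv w\<close>, \<open>U_elem_conj\<close> writes the conjugate of a
  generator as a word in generators of \<open>U\<close>; \<open>act_closed\<close> then places it in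
  \<open>U_set\<close>.\<close>

lemma U_set_normal:
  assumes "w \<in> words (sb_gens (n - 1) g p)" "2 \<le> n" "x \<in> U_set"
  shows "ev f w * x * (ev f w)\<^sup>- \<in> U_set"
proof -
  obtain v where v: "v \<in> words (sb_gens n g p)" "x = ev f (U_word n v)"
    using assms(3) by (auto simp: U_set_def)
  have gen: "ev f w * U_elem d * (ev f w)\<^sup>- \<in> U_set" for d
    using U_elem_conj[of "winv w" d] assms act_closed[of U_set U_elem] U_set_closed U_elem_in_U_set
    by simp
  have "ev f w * ev (\<lambda>d. ev f (U_gen n d)) v * (ev f w)\<^sup>- \<in> U_set"
    using v(1)
  proof (induction v)
    case Nil
    then show ?case by (simp add: U_set_closed)
  next
    case (Cons l v)
    obtain d e where l: "l = (d, e)" by (cases l)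
    let ?h = "\<lambda>x. ev f w * x * (ev f w)\<^sup>-"
    have d: "ev f (U_gen n d) = U_elem d" using Cons.prems by (simp add: l U_elem_def)
    have "?h (if e then U_elem d else (U_elem d)\<^sup>-) \<in> U_set"
      using gen[of d] U_set_closed(3)[OF gen[of d]] by (simp add: mult.assoc)
    then have "?h (if e then U_elem d else (U_elem d)\<^sup>-) * ?h (ev (\<lambda>d. ev f (U_gen n d)) v) \<in> U_set"
      by (rule U_set_closed(2)) (use Cons in \<open>simp add: l\<close>)
    then show ?case
      by (cases e) (simp_all add: l d mult.assoc)
  qed
  then show ?thesis
    by (simp add: v ev_U_word)
qed

text \<open>The elements \<open>D n k\<close> with k < n serve as representatives for the cosets of
  U B(n-1). A letter either passes through the representative and becomes a letter of the smaller
  group (\<open>pass\<close>), or changes the representative up to an element of \<open>U\<close>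
  (\<open>absorb\<close>).\<close>

lemma coset_step:
  assumes "l \<in> sb_gens n g p \<times> UNIV" "k < n" "2 \<le> n"
  shows "\<exists>x\<in>U_set. \<exists>h\<in>words (sb_gens (n - 1) g p). \<exists>k'<n. D n k * ev f [l] = x * ev f h * D n k'"
proof -
  obtain c e where l: "l = (c, e)" "c \<in> sb_gens n g p" using assms by (cases l) auto
  have pass: ?thesis if "D n k * f c = f c' * D n k" "c' \<in> sb_gens (n - 1) g p" for c'
  proof -
    have "D n k * ev f [l] = 1 * ev f [(c', e)] * D n k"
      using that intertwine_ginv(1)[OF that(1)] by (simp add: l)
    then show ?thesis
      using that assms U_set_closed(1) by (metis words_Cons words_Nil)
  qed
  have absorb: ?thesis if "D n k * ev f [l] = x * D n k'" "x \<in> U_set" "k' < n" for x k'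
    using that by (metis ev.simps(1) mult_1_right words_Nil)
  show ?thesis
  proof (cases "loop c")
    case True
    then have cl: "c \<in> loops" using l by (auto simp: sb_gens_def loops_def loop_def)
    show ?thesis
    proof (cases "k = 0")
      case True
      have "D n k * ev f [l] = (if e then U_elem c else (U_elem c)\<^sup>-) * D n k"
        using l cl True by (simp add: U_elem_first_gens first_gens_loop loops_loop mult.assoc)
      moreover have "(if e then U_elem c else (U_elem c)\<^sup>-) \<in> U_set"
        using U_elem_in_U_set U_set_closed by simp
      ultimately show ?thesis using assms by (intro absorb)
    next
      case False
      then show ?thesis
        using cl assms by (intro pass[of c] D_commute_loop) (auto simp: sb_gens_def loops_def)
    qed
  next
    case False
    then obtain i where c: "c = Sigma i" by (auto simp: loop_def)
    then have i: "1 \<le> i" "i < n" using l by (auto simp: sb_gens_def)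
    \<comment> \<open>A full twist next to \<open>D n j\<close> comes out on the left as a generator
      of \<open>U\<close>; this is the correction in the two cases where the letter meets an end of
      the descending product.\<close>
    have U: "U_elem (Sigma j) * D n j = D n j * (s j * s j)" if "1 \<le> j" "j < n" for j
      using that by (simp add: U_elem_def sb_gens_def U_gen_simps mult.assoc flip: D_def)
    consider "i < k" | "i = k" | "i = Suc k" | "Suc k < i" by linarith
    then show ?thesis
    proof cases
      case 1
      then show ?thesis
        using i c assms by (intro pass[of c]) (auto intro: D_commute_low simp: sb_gens_def)
    next
      case 2
      have Dk: "D n (k - 1) = D n k * s k" using D_snoc[of "k - 1" n] 2 i by simp
      show ?thesis
      proof (cases e)
        case True
        then show ?thesis
          using 2 c l assms U_set_closed(1) Dk by (intro absorb[of 1 "k - 1"]) simp_all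
      next
        case False
        have "U_elem (Sigma k) * (D n k * (s k)\<^sup>-) = D n (k - 1)"
          using mult_eq_assoc[OF U[of k], of "(s k)\<^sup>-"] 2 i Dk by (simp add: mult.assoc)
        then have "D n k * (s k)\<^sup>- = (U_elem (Sigma k))\<^sup>- * D n (k - 1)"
          by (metis left_ginv_cancel)
        then show ?thesis
          using 2 c l assms False U_elem_in_U_set U_set_closed
          by (intro absorb[of "(U_elem (Sigma k))\<^sup>-" "k - 1"]) simp_all
      qed
    next
      case 3
      have Dk: "D n k = D n i * s i" using D_snoc[of k n] 3 i by simp
      show ?thesis
      proof (cases e)
        case True
        then show ?thesis
          using 3 c l i U[of i] U_elem_in_U_set by (intro absorb[of "U_elem (Sigma i)" i]) (simp_all add: Dk mult.assoc)
      next
        case False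
        then show ?thesis
          using 3 c l i U_set_closed by (intro absorb[of 1 i]) (simp_all add: Dk mult.assoc)
      qed
    next
      case 4
      then show ?thesis
        using i c D_shift[of k "i - 1" n] by (intro pass[of "Sigma (i - 1)"]) auto
    qed
  qed
qed

text \<open>Letters are appended on the right, next to the representative, and the new factor from
  \<open>U\<close> is moved left past the smaller braid by normality.\<close>

lemma coset_decomposition:
  assumes "w \<in> words (sb_gens n g p)" "2 \<le> n"
  shows "\<exists>v\<in>words (sb_gens n g p). \<exists>h\<in>words (sb_gens (n - 1) g p). \<exists>k<n.
    ev f w = ev f (U_word n v @ h @ sg_down n k)"
proof -
  have "\<exists>x\<in>U_set. \<exists>h\<in>words (sb_gens (n - 1) g p). \<exists>k<n. ev f w = x * ev f h * D n k"
    using assms(1)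
  proof (induction w rule: rev_induct)
    case Nil
    \<comment> \<open>The trivial representative is the one with k = n - 1.\<close>
    have "ev f [] = 1 * ev f [] * D n (n - 1)" by simp
    then show ?case
      using U_set_closed(1) assms(2) by (intro bexI[of _ 1] bexI[of _ "[]"] exI[of _ "n - 1"] conjI) auto
  next
    case (snoc l w)
    then obtain x h k where 1: "x \<in> U_set" "h \<in> words (sb_gens (n - 1) g p)" "k < n"
      "ev f w = x * ev f h * D n k"
      by auto
    have "l \<in> sb_gens n g p \<times> UNIV"
      using snoc.prems by (cases l) auto
    from coset_step[OF this 1(3) assms(2)] obtain y i j where 2: "y \<in> U_set"
      "i \<in> words (sb_gens (n - 1) g p)" "j < n" "D n k * ev f [l] = y * ev f i * D n j"
      by blast
    have "ev f (w @ [l]) = x * ev f h * (D n k * ev f [l])"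
      unfolding ev_append 1(4) by (simp only: mult.assoc)
    also have "\<dots> = (x * (ev f h * y * (ev f h)\<^sup>-)) * ev f (h @ i) * D n j"
      unfolding 2(4) by (simp add: mult.assoc)
    finally show ?case
      using U_set_closed(2)[OF 1(1) U_set_normal[OF 1(2) assms(2) 2(1)]] 1(2) 2(2,3) by (metis words_append)
  qed
  then show ?thesis
    by (auto simp: U_set_def D_def mult.assoc)
qed

end

section \<open>Faithfulness\<close>

abbreviation sb_eq :: "nat \<Rightarrow> nat \<Rightarrow> nat \<Rightarrow> sbgen word \<Rightarrow> sbgen word \<Rightarrow> bool" where
  "sb_eq n g p \<equiv> pres_eq (sb_gens n g p) (sb_rels n g p)"

abbreviation sb_cayley :: "nat \<Rightarrow> nat \<Rightarrow> nat \<Rightarrow> sbgen \<Rightarrow> sbgen word set sym" where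
  "sb_cayley n g p \<equiv> cayley (sb_gens n g p) (sb_rels n g p)"

interpretation sb_cayley: sb_rep n g p "sb_cayley n g p" for n g p
  by standard (simp add: ev_cayley_iff pres_eq.rel)

lemma sb_eq_mono: "sb_eq m g p u v \<Longrightarrow> m \<le> n \<Longrightarrow> sb_eq n g p u v"
  by (rule pres_eq_mono[OF _ sb_gens_mono sb_rels_mono])

text \<open>Evaluating \<open>v\<close> at the generators of \<open>U\<close> in the regular
  representation gives the value of the braid \<open>U_word m v\<close> itself.\<close>

lemma U_word_trivial:
  assumes "v \<in> words (sb_gens m g p)" "1 \<le> m"
    and "\<And>h :: sbgen \<Rightarrow> sbgen word set sym wr. act (U_word m v) h (Sigma m) = h (Sigma m)"
  shows "sb_eq m g p (U_word m v) []"
proof -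
  have "ev (sb_cayley m g p) (U_word m v) = 1"
    using U_word_faithful[OF assms] by (simp add: ev_U_word)
  then show ?thesis
    using ev_cayley_iff[of "U_word m v" "sb_gens m g p" "[]" "sb_rels m g p"] assms(1)
    by (simp add: U_word_words)
qed

text \<open>On one strand only loops remain and \<open>sg_down 1 0\<close> is empty, so
  \<open>U\<close> is the whole group. This starts the induction on strands.\<close>

lemma U_word_one_strand: "w \<in> words (sb_gens 1 g p) \<Longrightarrow> U_word 1 w = w"
proof (induction w)
  case (Cons l w)
  then obtain d e where "l = (d, e)" "loop d"
    by (cases l) (auto simp: sb_gens_def)
  with Cons show ?case
    by (simp add: U_gen_simps winv_def)
qed simp

text \<open>
  Induction on the number of strands: a word that acts trivially fixes the last strand, so it lies in
  \<open>U B (m-1)\<close>. Tuples with the value 1 at the last strand show that the second factor acts trivially,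
  and tuples in a wreath product detect the first.
\<close>

lemma act_faithful:
  assumes "1 \<le> m" "w \<in> words (sb_gens m g p)"
    and "\<And>(h :: sbgen \<Rightarrow> sbgen word set sym wr) d. d \<in> sb_gens (Suc m) g p \<Longrightarrow> act w h d = h d"
  shows "sb_eq m g p w []"
  using assms
proof (induction m arbitrary: w rule: dec_induct)
  case base
  have "sb_eq 1 g p (U_word 1 w) []"
    by (rule U_word_trivial[OF base(1)]) (unfold U_word_one_strand[OF base(1)], simp_all add: base(2))
  then show ?case
    by (simp only: U_word_one_strand[OF base(1)])
next
  case (step m)
  let ?m = "Suc m"
  obtain v h k where v: "v \<in> words (sb_gens ?m g p)" and h: "h \<in> words (sb_gens m g p)" and k: "k < ?m"
    and ev: "ev (sb_cayley ?m g p) w = ev (sb_cayley ?m g p) (U_word ?m v @ h @ sg_down ?m k)"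
    using sb_cayley.coset_decomposition[OF step.prems(1)] step.hyps(1) by auto
  have h': "h \<in> words (sb_gens ?m g p)"
    using h by (rule words_mono) (simp add: sb_gens_mono)
  have eq: "sb_eq ?m g p w (U_word ?m v @ h @ sg_down ?m k)"
    using ev by (subst (asm) ev_cayley_iff) (simp_all add: step.prems U_word_words v h' sg_down_words)
  have U: "act (U_word ?m v) f = f" if "f (Sigma ?m) = 1" for f :: "sbgen \<Rightarrow> 'b::mult_group"
    using act_U_word_fix[where f = f, OF v _ that] by simp
  have last: "act h f (Sigma ?m) = f (Sigma ?m)" for f :: "sbgen \<Rightarrow> 'b::mult_group"
    by (rule act_other_strand[OF h step.hyps(1)]) simp
  have "k = m"
  proof (rule ccontr)
    assume "k \<noteq> m"
    \<comment> \<open>The only trivial entry is the one that \<open>sg_down\<close> carries to the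
      last strand. There the factor from \<open>U\<close> leaves it, so \<open>w\<close> would move
      it unless k = m.\<close>
    define f where "f = (\<lambda>_. Wr {1} 1 :: sbgen word set sym wr)(Sigma (Suc k) := 1)"
    define f' where "f' = act h (act (sg_down ?m k) f)"
    have "f' (Sigma ?m) = 1"
      using k by (simp add: f'_def last act_sg_down_last f_def)
    then have "act w f (Sigma ?m) = 1"
      by (simp add: act_pres_eq[OF eq] U flip: f'_def)
    then have "f (Sigma ?m) = 1"
      by (simp add: step.prems(2))
    then show False
      using \<open>k \<noteq> m\<close> by (simp add: f_def one_wr_def)
  qed
  then have eq: "sb_eq ?m g p w (U_word ?m v @ h)"
    using eq by simp
  have "sb_eq m g p h []"
  proof (rule step.IH[OF h])
    fix f :: "sbgen \<Rightarrow> sbgen word set sym wr" and d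
    assume d: "d \<in> sb_gens ?m g p"
    have "(act h f)(Sigma ?m := 1) = act h (f(Sigma ?m := 1))"
      by (rule act_upd_strand[OF h step.hyps(1), symmetric]) simp
    also have "\<dots> = act w (f(Sigma ?m := 1))"
      by (simp add: act_pres_eq[OF eq] U last)
    finally have *: "(act h f)(Sigma ?m := 1) = act w (f(Sigma ?m := 1))" .
    \<comment> \<open>The induction hypothesis tests strand entries only up to
      \<open>Sigma m\<close>, so the overwritten entry is never inspected.\<close>
    have "d \<in> sb_gens (Suc ?m) g p" "d \<noteq> Sigma ?m"
      using d by (auto simp: sb_gens_def)
    then show "act h f d = f d"
      using fun_cong[OF *, of d] step.prems(2) by simp
  qed
  then have "sb_eq ?m g p h []"
    by (rule sb_eq_mono) simp
  from pres_eq.cong[OF this U_word_words[OF v], of "[]"]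
  have "sb_eq ?m g p (U_word ?m v @ h) (U_word ?m v)"
    by simp
  with eq have eq: "sb_eq ?m g p w (U_word ?m v)"
    by (rule pres_eq.trans)
  have "sb_eq ?m g p (U_word ?m v) []"
    by (rule U_word_trivial[OF v]) (simp_all add: step.prems(2) flip: act_pres_eq[OF eq])
  with eq show ?case
    by (rule pres_eq.trans)
qed

lemma wr_tuple_top: "d \<noteq> Sigma m \<Longrightarrow> wr_top (wr_tuple m f d) = f d"
  by (simp add: wr_tuple_def)

lemma act_wr_tuple:
  assumes "w \<in> words (sb_gens m g p)" "1 \<le> m" "m < n"
  shows "act w (wr_tuple n f) = wr_tuple n (act w f)"
  unfolding wr_tuple_def act_upd_strand[OF assms] act_natural[OF Wr_hom] ..

text \<open>
  A generator of \<open>U\<close> moves the last entry of a generic tuple to its conjugate by the corresponding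
  entry, so a braid that commutes with it preserves that entry.
\<close>

lemma U_centralizer_trivial:
  assumes w: "w \<in> words (sb_gens (n - 1) g p)" and n: "2 \<le> n"
    and comm: "\<And>d. d \<in> sb_gens n g p \<Longrightarrow> sb_eq n g p (U_gen n d @ w) (w @ U_gen n d)"
  shows "sb_eq (n - 1) g p w []"
proof (rule act_faithful)
  show "1 \<le> n - 1" "w \<in> words (sb_gens (n - 1) g p)"
    using n w by simp_all
  fix f :: "sbgen \<Rightarrow> sbgen word set sym wr" and d
  assume "d \<in> sb_gens (Suc (n - 1)) g p"
  then have d: "d \<in> sb_gens n g p" using n by simp
  have n1: "1 \<le> n - 1" "n - 1 < n" "1 \<le> n" using n by simp_all
  define F where "F = wr_tuple n f"
  define F' where "F' = wr_tuple n (act w f)"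
  have FF': "act w F = F'"
    unfolding F_def F'_def by (rule act_wr_tuple[OF w n1(1,2)])
  have FN: "F (Sigma n) = Wr {1} 1" "F' (Sigma n) = Wr {1} 1"
    by (simp_all add: F_def F'_def wr_tuple_def)
  \<comment> \<open>The last entry is computed in both orders: pushing after \<open>w\<close>
    conjugates by \<open>F' d\<close>, pushing before \<open>w\<close> conjugates by
    \<open>F d\<close>, and \<open>w\<close> leaves the last entry alone.\<close>
  have "F' d * Wr {1} 1 * (F' d)\<^sup>- = act (U_gen n d) F' (Sigma n)"
    using act_U_gen_last[OF d n1(3), of F'] FN by simp
  also have "\<dots> = act w (act (U_gen n d) F) (Sigma n)"
    using act_pres_eq[OF comm[OF d], of F] by (simp add: FF')
  also have "\<dots> = act (U_gen n d) F (Sigma n)"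
    by (rule act_other_strand[OF w n1(1,2)])
  also have "\<dots> = F d * Wr {1} 1 * (F d)\<^sup>-"
    using act_U_gen_last[OF d n1(3), of F] FN by simp
  finally have "wr_top (F' d) = wr_top (F d)"
    by (rule wr_conj_point)
  moreover have "d \<noteq> Sigma n" using d by auto
  ultimately show "act w f d = f d"
    by (simp add: F_def F'_def wr_tuple_top)
qed

section \<open>From words to the groups and the conjugation homomorphism\<close>

lemma sb_elem_eq_iff: "u \<in> words (sb_gens n g p) \<Longrightarrow> sb_elem n g p u = sb_elem n g p v \<longleftrightarrow> sb_eq n g p u v"
  by (simp add: sb_elem_def wclass_eq_iff)

lemma carrier_sb_group: "carrier (sb_group n g p) = sb_elem n g p ` words (sb_gens n g p)"
  by (auto simp: sb_group_def presented_group_def sb_elem_def)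

lemma sb_elem_mult:
  "u \<in> words (sb_gens n g p) \<Longrightarrow> v \<in> words (sb_gens n g p) \<Longrightarrow>
    sb_elem n g p u \<otimes>\<^bsub>sb_group n g p\<^esub> sb_elem n g p v = sb_elem n g p (u @ v)"
  by (simp add: sb_elem_def sb_group_def wclass_mult)

lemma sb_elem_one: "\<one>\<^bsub>sb_group n g p\<^esub> = sb_elem n g p []"
  by (simp add: sb_elem_def sb_group_def presented_group_def)

interpretation sb_group: group "sb_group n g p" for n g p
  unfolding sb_group_def by (rule group_presented_group)

lemma sb_elem_inv:
  assumes "u \<in> words (sb_gens n g p)"
  shows "inv\<^bsub>sb_group n g p\<^esub> (sb_elem n g p u) = sb_elem n g p (winv u)"
  by (rule sb_group.inv_equality)
    (use assms in \<open>auto simp: carrier_sb_group sb_elem_mult sb_elem_one sb_elem_eq_iff winv_cancel\<close>)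

lemma U_group_gens:
  "sb_elem n g p ` (tau n ` {1..<n} \<union> w_gen n ` {1..2 * g} \<union> xi n ` {1..<p}) =
    (\<lambda>d. sb_elem n g p (U_gen n d)) ` sb_gens n g p"
  by (simp add: sb_gens_def image_Un image_image U_gen_def)

lemma carrier_U_group:
  "carrier (U_group n g p) = (\<lambda>v. sb_elem n g p (U_word n v)) ` words (sb_gens n g p)"
proof -
  let ?S = "(\<lambda>d. sb_elem n g p (U_gen n d)) ` sb_gens n g p"
  have S: "?S \<subseteq> carrier (sb_group n g p)"
    by (auto simp: carrier_sb_group U_gen_words)
  have U: "carrier (U_group n g p) = generate (sb_group n g p) ?S"
    unfolding U_group_def U_group_gens carrier_subgroup_generated using S by (simp add: Int_absorb1)
  have "\<exists>v\<in>words (sb_gens n g p). x = sb_elem n g p (U_word n v)"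
    if "x \<in> generate (sb_group n g p) ?S" for x
    using that
  proof induction
    case one
    show ?case by (rule bexI[of _ "[]"]) (simp_all add: sb_elem_one)
  next
    case (incl h)
    then obtain d where "d \<in> sb_gens n g p" "h = sb_elem n g p (U_gen n d)" by auto
    then show ?case by (intro bexI[of _ "[(d, True)]"]) simp_all
  next
    case (inv h)
    then obtain d where "d \<in> sb_gens n g p" "h = sb_elem n g p (U_gen n d)" by auto
    then show ?case by (intro bexI[of _ "[(d, False)]"]) (simp_all add: sb_elem_inv U_gen_words)
  next
    case (eng x y)
    then obtain u v where uv: "u \<in> words (sb_gens n g p)" "v \<in> words (sb_gens n g p)"
      "x = sb_elem n g p (U_word n u)" "y = sb_elem n g p (U_word n v)"
      by auto
    have "U_word n (u @ v) = U_word n u @ U_word n v"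
      by (induction n u rule: U_word.induct) simp_all
    with uv show ?case
      by (intro bexI[of _ "u @ v"]) (simp_all add: sb_elem_mult U_word_words)
  qed
  moreover have "sb_elem n g p (U_word n v) \<in> generate (sb_group n g p) ?S"
    if "v \<in> words (sb_gens n g p)" for v
    using that
  proof (induction v)
    case Nil
    then show ?case using generate.one[of "sb_group n g p" ?S] by (simp add: sb_elem_one)
  next
    case (Cons l v)
    obtain d e where l: "l = (d, e)" by (cases l)
    have d: "d \<in> sb_gens n g p" and v: "v \<in> words (sb_gens n g p)"
      using Cons.prems l by auto
    let ?u = "if e then U_gen n d else winv (U_gen n d)"
    have "sb_elem n g p ?u \<in> generate (sb_group n g p) ?S"
      using d by (auto intro: generate.incl generate.inv simp: U_gen_words simp flip: sb_elem_inv)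
    then have "sb_elem n g p ?u \<otimes>\<^bsub>sb_group n g p\<^esub> sb_elem n g p (U_word n v) \<in> generate (sb_group n g p) ?S"
      using Cons.IH[OF v] by (rule generate.eng)
    then show ?case
      using d v by (simp add: l sb_elem_mult U_gen_words U_word_words split: if_splits)
  qed
  ultimately show ?thesis
    unfolding U by blast
qed

lemma U_conj_closed:
  assumes w: "w \<in> words (sb_gens (n - 1) g p)" and n: "2 \<le> n" and u: "u \<in> carrier (U_group n g p)"
  shows "inv\<^bsub>sb_group n g p\<^esub> (sb_elem n g p w) \<otimes>\<^bsub>sb_group n g p\<^esub> u \<otimes>\<^bsub>sb_group n g p\<^esub> sb_elem n g p w
    \<in> carrier (U_group n g p)"
proof -
  obtain v where v: "v \<in> words (sb_gens n g p)" "u = sb_elem n g p (U_word n v)"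
    using u by (auto simp: carrier_U_group)
  have w': "w \<in> words (sb_gens n g p)"
    using w by (rule words_mono) (simp add: sb_gens_mono)
  let ?w = "winv w @ U_word n v @ w"
  \<comment> \<open>Normality is taken from the regular representation, and
    \<open>ev_cayley_iff\<close> carries it back to braids.\<close>
  have "ev (sb_cayley n g p) ?w \<in> sb_cayley.U_set n g p"
    using sb_cayley.U_set_normal[of "winv w" n g p "ev (sb_cayley n g p) (U_word n v)"] w n v
    by (simp add: sb_cayley.U_set_def mult.assoc)
  then obtain v' where v': "v' \<in> words (sb_gens n g p)"
    "ev (sb_cayley n g p) ?w = ev (sb_cayley n g p) (U_word n v')"
    by (auto simp: sb_cayley.U_set_def)
  then have "sb_eq n g p ?w (U_word n v')"
    by (subst (asm) ev_cayley_iff) (simp_all add: w' v U_word_words)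
  then have "sb_elem n g p ?w = sb_elem n g p (U_word n v')"
    by (simp add: sb_elem_eq_iff w' v U_word_words)
  then show ?thesis
    using v v' w' by (simp add: sb_elem_inv sb_elem_mult U_word_words carrier_U_group)
qed

theorem theorem2:
  fixes g p n :: nat
  assumes "p > 0" and "n \<ge> 3"
  shows "rho_U n g p \<in> hom (sb_group (n - 1) g p) (right_AutoGroup (U_group n g p))
       \<and> inj_on (rho_U n g p) (carrier (sb_group (n - 1) g p))"
proof -
  define m where m: "m = n - 1"
  let ?G = "sb_group n g p" and ?U = "U_group n g p" and ?B = "sb_group m g p"
  let ?W = "words (sb_gens m g p)" and ?e = "sb_elem n g p"
  have n2: "2 \<le> n" using assms by simp
  have W: "w \<in> words (sb_gens n g p)" if "w \<in> ?W" for w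
    using that by (rule words_mono) (simp add: sb_gens_mono m)
  have eG [simp]: "?e w \<in> carrier ?G" if "w \<in> ?W" for w
    using W[OF that] by (simp add: carrier_sb_group)
  have U_sub: "u \<in> carrier ?G" if "u \<in> carrier ?U" for u
    using that by (auto simp: carrier_U_group carrier_sb_group U_word_words)
  have U_mult: "mult ?U = mult ?G"
    by (simp add: U_group_def)
  have rho: "rho_U n g p (sb_elem m g p w) = (\<lambda>u\<in>carrier ?U. inv\<^bsub>?G\<^esub> (?e w) \<otimes>\<^bsub>?G\<^esub> u \<otimes>\<^bsub>?G\<^esub> ?e w)"
    if "w \<in> ?W" for w
    unfolding m rho_U_def by (simp only: sb_incl_elem[OF that[unfolded m]])
  have closed: "rho_U n g p (sb_elem m g p w) u \<in> carrier ?U" if "w \<in> ?W" "u \<in> carrier ?U" for w u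
    using that by (simp add: rho U_conj_closed[where n = n, folded m] n2)
  have comp: "rho_U n g p (sb_elem m g p (v @ w)) u =
      rho_U n g p (sb_elem m g p w) (rho_U n g p (sb_elem m g p v) u)"
    if "v \<in> ?W" "w \<in> ?W" "u \<in> carrier ?U" for v w u
  proof -
    have "?e (v @ w) = ?e v \<otimes>\<^bsub>?G\<^esub> ?e w"
      using that W by (simp add: sb_elem_mult)
    then show ?thesis
      using that closed[OF that(1,3)] U_sub[OF that(3)]
      by (simp add: rho sb_group.inv_mult_group sb_group.m_assoc)
  qed
  have triv: "rho_U n g p (sb_elem m g p w) u = u"
    if "w \<in> ?W" "sb_eq m g p w []" "u \<in> carrier ?U" for w u
  proof -
    have "?e w = \<one>\<^bsub>?G\<^esub>"
      using sb_eq_mono[OF that(2), of n] W[OF that(1)] m by (simp add: sb_elem_one sb_elem_eq_iff)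
    then show ?thesis
      using that U_sub by (simp add: rho)
  qed
  have auto: "rho_U n g p (sb_elem m g p w) \<in> auto ?U" if w: "w \<in> ?W" for w
  proof -
    have cancel: "?e w \<otimes>\<^bsub>?G\<^esub> (inv\<^bsub>?G\<^esub> (?e w) \<otimes>\<^bsub>?G\<^esub> z) = z" if "z \<in> carrier ?G" for z
      using that w by (simp flip: sb_group.m_assoc)
    have "rho_U n g p (sb_elem m g p w) \<in> hom ?U ?U"
    proof (rule homI)
      fix x y assume xy: "x \<in> carrier ?U" "y \<in> carrier ?U"
      have "x \<otimes>\<^bsub>?U\<^esub> y \<in> carrier ?U"
        using xy group.group_subgroup_generated[OF sb_group.is_group] unfolding U_group_def
        by (meson group.is_monoid monoid.m_closed)
      then show "rho_U n g p (sb_elem m g p w) (x \<otimes>\<^bsub>?U\<^esub> y) =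
          rho_U n g p (sb_elem m g p w) x \<otimes>\<^bsub>?U\<^esub> rho_U n g p (sb_elem m g p w) y"
        using w xy U_sub by (simp add: rho U_mult sb_group.m_assoc cancel)
    qed (simp add: closed w)
    moreover have "bij_betw (rho_U n g p (sb_elem m g p w)) (carrier ?U) (carrier ?U)"
    \<comment> \<open>The inverse braid gives the inverse map: by \<open>comp\<close> and
      \<open>triv\<close>, the two composites are actions of words equal to the empty word.\<close>
    proof (rule bij_betw_byWitness[where f' = "rho_U n g p (sb_elem m g p (winv w))"])
      show "\<forall>u\<in>carrier ?U. rho_U n g p (sb_elem m g p (winv w)) (rho_U n g p (sb_elem m g p w) u) = u"
        using w winv_cancel_right[OF w] by (simp add: triv flip: comp)
      show "\<forall>u\<in>carrier ?U. rho_U n g p (sb_elem m g p w) (rho_U n g p (sb_elem m g p (winv w)) u) = u"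
        using w winv_cancel[OF w] by (simp add: triv flip: comp)
    qed (use w closed in auto)
    ultimately show ?thesis
      using w by (simp add: auto_def Bij_def rho)
  qed
  have "rho_U n g p \<in> hom ?B (right_AutoGroup ?U)"
  proof (rule homI)
    fix \<alpha> assume "\<alpha> \<in> carrier ?B"
    then show "rho_U n g p \<alpha> \<in> carrier (right_AutoGroup ?U)"
      by (auto simp: carrier_sb_group right_AutoGroup_def AutoGroup_def auto)
  next
    fix \<alpha> \<beta> assume "\<alpha> \<in> carrier ?B" "\<beta> \<in> carrier ?B"
    then obtain a b where ab: "a \<in> ?W" "b \<in> ?W" "\<alpha> = sb_elem m g p a" "\<beta> = sb_elem m g p b"
      by (auto simp: carrier_sb_group)
    have Bij: "rho_U n g p \<alpha> \<in> Bij (carrier ?U)" "rho_U n g p \<beta> \<in> Bij (carrier ?U)"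
      using auto ab by (auto simp: auto_def)
    have "rho_U n g p (sb_elem m g p (a @ b)) = compose (carrier ?U) (rho_U n g p \<beta>) (rho_U n g p \<alpha>)"
      using comp[OF ab(1,2)] ab by (auto simp: fun_eq_iff compose_def rho)
    then show "rho_U n g p (\<alpha> \<otimes>\<^bsub>?B\<^esub> \<beta>) = rho_U n g p \<alpha> \<otimes>\<^bsub>right_AutoGroup ?U\<^esub> rho_U n g p \<beta>"
      using ab Bij by (simp add: sb_elem_mult right_AutoGroup_def AutoGroup_def BijGroup_def)
  qed
  moreover have "inj_on (rho_U n g p) (carrier ?B)"
  proof (rule inj_onI)
    fix \<alpha> \<beta> assume "\<alpha> \<in> carrier ?B" "\<beta> \<in> carrier ?B" and eq: "rho_U n g p \<alpha> = rho_U n g p \<beta>"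
    then obtain a b where ab: "a \<in> ?W" "b \<in> ?W" "\<alpha> = sb_elem m g p a" "\<beta> = sb_elem m g p b"
      by (auto simp: carrier_sb_group)
    \<comment> \<open>Since \<open>a\<close> and \<open>b\<close> induce the same automorphism, this
      quotient acts on \<open>U\<close> as \<open>b @ winv b\<close> does, hence trivially; so it
      commutes with the generators of \<open>U\<close> in the larger group.\<close>
    let ?w = "a @ winv b"
    have w: "?w \<in> ?W" using ab by simp
    have "sb_eq m g p ?w []"
    proof (rule U_centralizer_trivial[where n = n, folded m, OF w n2])
      fix d assume d: "d \<in> sb_gens n g p"
      have u: "?e (U_gen n d) \<in> carrier ?U"
        unfolding carrier_U_group using d by (intro image_eqI[of _ _ "[(d, True)]"]) simp_all
      have "rho_U n g p (sb_elem m g p ?w) (?e (U_gen n d)) =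
          rho_U n g p (sb_elem m g p (b @ winv b)) (?e (U_gen n d))"
        using ab u eq by (simp add: comp)
      also have "\<dots> = ?e (U_gen n d)"
        using ab u winv_cancel_right[OF ab(2)] by (simp add: triv)
      finally have "inv\<^bsub>?G\<^esub> (?e ?w) \<otimes>\<^bsub>?G\<^esub> (?e (U_gen n d) \<otimes>\<^bsub>?G\<^esub> ?e ?w) = ?e (U_gen n d)"
        using w u U_sub by (simp add: rho sb_group.m_assoc del: words_append)
      then have "?e (U_gen n d) \<otimes>\<^bsub>?G\<^esub> ?e ?w = ?e ?w \<otimes>\<^bsub>?G\<^esub> ?e (U_gen n d)"
        using w u U_sub by (metis eG sb_group.inv_solve_left sb_group.m_closed)
      then show "sb_eq n g p (U_gen n d @ ?w) (?w @ U_gen n d)"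
        using W[OF w] d by (simp only: sb_elem_mult U_gen_words sb_elem_eq_iff words_append)
    qed
    from pres_eq.cong[OF this, of "[]" b] ab(2)
    have "sb_eq m g p (a @ winv b @ b) b"
      by simp
    moreover have "sb_eq m g p (a @ winv b @ b) a"
      using pres_eq.cong[OF winv_cancel[OF ab(2)] ab(1), of "[]"] by simp
    ultimately have "sb_eq m g p a b"
      using pres_eq.sym pres_eq.trans by metis
    then show "\<alpha> = \<beta>"
      using ab by (simp add: sb_elem_eq_iff)
  qed
  ultimately show ?thesis
    by (simp only: m)
qed

end
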